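(* Fix $1 \leq p<\infty$ and let $f\in\mathscr{H}^\infty$ with Dirichlet series $f(s)=\sum_{n\ge1}a_nn^{-s}$, and set $f(+\infty)=a_1$. Then \[\lim_{T\to\infty} \left|\frac{1}{2T} \int_{-T}^T |f(i\tau)|^p \,d\tau - |f(+\infty)|^p - \frac{p^2}{2T}\int_0^\infty \int_{-T}^T |f(\sigma+it)|^{p-2} |f'(\sigma+it)|^2 \,\sigma\, dt\, d\sigma \right|=0,\] where $f(i\tau)=\lim_{\sigma\to0^+}f(\sigma+i\tau)$ denotes the boundary value, which exists for almost every $\tau\in\mathbb{R}$.
   Context: For $\kappa\in\mathbb{R}$ let $\mathbb{C}_\kappa=\{s=\sigma+it:\sigma>\kappa\}$. $\mathscr{H}^\infty$ denotes the set of bounded analytic functions $f$ on $\mathbb{C}_0$ that can be represented by a Dirichlet series $\sum_{n\geq1}a_n n^{-s}$ converging in $\mathbb{C}_\kappa$ for some $\kappa>0$. *)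

theory Defs
  imports "HOL-Analysis.Analysis"
begin

definition halfplane :: "real \<Rightarrow> complex set" where
  "halfplane \<kappa> = {s. Re s > \<kappa>}"

text \<open>f belongs to H-infinity with Dirichlet coefficients a (a 1, a 2, ...; a 0 unused):
  f is bounded and holomorphic on C_0, and the Dirichlet series sum_{n>=1} a_n n^(-s)
  converges to f(s) on C_kappa for some kappa > 0.\<close>
definition Hinf_dirichlet :: "(complex \<Rightarrow> complex) \<Rightarrow> (nat \<Rightarrow> complex) \<Rightarrow> bool" where
  "Hinf_dirichlet f a \<longleftrightarrow>
     f holomorphic_on halfplane 0 \<and>
     bounded (f ` halfplane 0) \<and>
     (\<exists>\<kappa>>0. \<forall>s\<in>halfplane \<kappa>.
        (\<lambda>n. a (Suc n) * of_nat (Suc n) powr (- s)) sums f s)"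

definition LP_area :: "(complex \<Rightarrow> complex) \<Rightarrow> real \<Rightarrow> real \<Rightarrow> ennreal" where
  "LP_area f p T =
     (\<integral>\<^sup>+ \<sigma>\<in>{0<..}. (\<integral>\<^sup>+ t\<in>{-T..T}.
        ennreal (norm (f (Complex \<sigma> t)) powr (p - 2) * (norm (deriv f (Complex \<sigma> t)))\<^sup>2 * \<sigma>)
        \<partial>lborel) \<partial>lborel)"

end

theory Submission
  imports Defs "HOL-Complex_Analysis.Complex_Analysis"
begin

text \<open>
  Smooth \<open>|f|\<^sup>p\<close> to \<open>u = (|f|\<^sup>2 + \<epsilon>) powr (p / 2)\<close>. Integrating \<open>(\<sigma> - \<delta>) \<Delta>u\<close> over the rectangle
  \<open>[\<delta>, R] \<times> [-T, T]\<close>, by parts twice in \<open>\<sigma>\<close> and once in \<open>t\<close>, gives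
  \<open>\<integral> u(\<delta> + it) dt - \<integral> u(R + it) dt\<close> up to a term at \<open>\<sigma> = R\<close>, which vanishes as \<open>R \<rightarrow> \<infinity>\<close>, and
  the term \<open>\<integral> (\<sigma> - \<delta>) (\<partial>\<^sub>t u(\<sigma> + iT) - \<partial>\<^sub>t u(\<sigma> - iT)) d\<sigma>\<close> on the horizontal sides. Since \<open>p \<ge> 1\<close>,
  \<open>|\<partial>\<^sub>t u|\<close> is at most a constant times \<open>|f'|\<close>, and \<open>\<sigma> |f'(\<sigma> + it)|\<close> is at most a constant times
  \<open>1 / (1 + \<sigma>\<^sup>2)\<close>: near the boundary by Cauchy's estimate, far away because the Dirichlet series
  tends to \<open>a\<^sub>1\<close> exponentially. So the horizontal sides contribute \<open>O(1)\<close>, uniformly in \<open>T\<close>, \<open>\<delta>\<close>, \<open>R\<close>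
  and \<open>\<epsilon>\<close>, which disappears after division by \<open>2T\<close>.

  Boundary values exist almost everywhere because a primitive of \<open>f\<close> is Lipschitz up to the imaginary
  axis, hence has a symmetric derivative there almost everywhere, and by a local Poisson formula \<open>f\<close>
  converges horizontally wherever it does.
\<close>

section \<open>Symmetric derivatives of Lipschitz functions\<close>

text \<open>Countable additivity carries a comparison valid on each ball over to the whole union. It
  serves below to compare a Stieltjes measure with Lebesgue measure on Vitali families.\<close>

lemma emeasure_disjoint_UN_le:
  fixes X :: "'i \<Rightarrow> 'a set"
  assumes "countable C" "disjoint_family_on X C"
    and "\<And>i. i \<in> C \<Longrightarrow> X i \<in> sets M" "\<And>i. i \<in> C \<Longrightarrow> X i \<in> sets N"
    and "\<And>i. i \<in> C \<Longrightarrow> c * emeasure M (X i) \<le> d * emeasure N (X i)"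
  shows "c * emeasure M (\<Union>i\<in>C. X i) \<le> d * emeasure N (\<Union>i\<in>C. X i)"
proof -
  have "c * emeasure M (\<Union>i\<in>C. X i) = (\<integral>\<^sup>+i. c * emeasure M (X i) \<partial>count_space C)"
    using assms by (subst emeasure_UN_countable) (auto simp: nn_integral_cmult)
  also have "\<dots> \<le> (\<integral>\<^sup>+i. d * emeasure N (X i) \<partial>count_space C)"
    using assms by (intro nn_integral_mono) auto
  also have "\<dots> = d * emeasure N (\<Union>i\<in>C. X i)"
    using assms by (subst emeasure_UN_countable) (auto simp: nn_integral_cmult)
  finally show ?thesis .
qed

text \<open>
  Cover \<open>S\<close> by disjoint balls of small slope inside a neighbourhood of \<open>S\<close> of nearly the same measure,
  and then by disjoint balls of large slope inside the first ones: the increase of \<open>\<phi>\<close> gives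
  \<open>R |S| \<le> r |S|\<close>.
\<close>
lemma symmetric_quotient_gap_null:
  fixes \<phi> :: "real \<Rightarrow> real"
  assumes mono: "mono \<phi>" and cont: "continuous_on UNIV \<phi>" and r: "0 < r" "r < R"
    and S: "S \<in> sets borel" "bounded S"
    and lo: "\<And>x d. x \<in> S \<Longrightarrow> 0 < d \<Longrightarrow> \<exists>h. 0 < h \<and> h < d \<and> \<phi> (x + h) - \<phi> (x - h) \<le> r * (2 * h)"
    and hi: "\<And>x d. x \<in> S \<Longrightarrow> 0 < d \<Longrightarrow> \<exists>h. 0 < h \<and> h < d \<and> R * (2 * h) \<le> \<phi> (x + h) - \<phi> (x - h)"
  shows "S \<in> null_sets lborel"
proof -
  \<comment> \<open>The Stieltjes measure of \<open>\<phi>\<close>. By continuity it has no atoms,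
    so the mass of a closed ball is exactly the increment of \<open>\<phi>\<close> across
    it.\<close>
  define \<mu> where "\<mu> = interval_measure \<phi>"
  have sets_\<mu> [simp]: "sets \<mu> = sets borel"
    by (simp add: \<mu>_def)
  have \<mu>_cball: "emeasure \<mu> (cball x h) = ennreal (\<phi> (x + h) - \<phi> (x - h))" if "0 < h" for x h
    unfolding \<mu>_def cball_eq_atLeastAtMost
    using that mono cont by (subst emeasure_interval_measure_Icc) (auto simp: mono_def)
  have \<mu>_ball: "emeasure \<mu> (ball x h) \<le> ennreal (\<phi> (x + h) - \<phi> (x - h))" if "0 < h" for x h
    unfolding \<mu>_cball[OF that, symmetric] by (intro emeasure_mono) auto
  have leb_ball: "emeasure lborel (ball x h) = ennreal (2 * h)"
    "emeasure lborel (cball x h) = ennreal (2 * h)" if "0 < h" for x h :: real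
    using that by (auto simp: ball_eq_greaterThanLessThan cball_eq_atLeastAtMost)
  have S_lt: "emeasure lborel S < \<infinity>"
    using S emeasure_bounded_finite by auto
  have key: "ennreal R * emeasure lborel S \<le> ennreal r * (emeasure lborel S + ennreal e)" if "0 < e" for e
  proof -
    obtain U where U: "open U" "S \<subseteq> U" "emeasure lborel (U - S) < ennreal e"
      using outer_regular_lborel[OF S(1) \<open>0 < e\<close>] by blast
    \<comment> \<open>Open balls of small slope: their union \<open>W\<close> is open, which leaves
      room around each of its points for the second covering.\<close>
    define K where "K = {(x, h). 0 < h \<and> ball x h \<subseteq> U \<and> \<phi> (x + h) - \<phi> (x - h) \<le> r * (2 * h)}"
    obtain C where C: "countable C" "C \<subseteq> K"
      "pairwise (\<lambda>i j. disjnt (ball (fst i) (snd i)) (ball (fst j) (snd j))) C"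
      "negligible (S - (\<Union>i\<in>C. ball (fst i) (snd i)))"
    proof (rule Vitali_covering_theorem_balls[of S K fst snd])
      fix x d :: real assume x: "x \<in> S" "0 < d"
      obtain d' where "0 < d'" "ball x d' \<subseteq> U"
        using U x by (meson open_contains_ball subsetD)
      moreover obtain h where "0 < h" "h < min d d'" "\<phi> (x + h) - \<phi> (x - h) \<le> r * (2 * h)"
        using lo[OF x(1), of "min d d'"] x \<open>0 < d'\<close> by auto
      ultimately show "\<exists>i. i \<in> K \<and> x \<in> ball (fst i) (snd i) \<and> snd i < d"
        by (intro exI[of _ "(x, h)"]) (auto simp: K_def)
    qed blast
    define W where "W = (\<Union>i\<in>C. ball (fst i) (snd i))"
    have W: "open W" "W \<subseteq> U"
      using C(2) by (auto simp: W_def K_def dest!: subsetD)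
    have "1 * emeasure \<mu> W \<le> ennreal r * emeasure lborel W"
      unfolding W_def
    proof (rule emeasure_disjoint_UN_le)
      show "disjoint_family_on (\<lambda>i. ball (fst i) (snd i)) C"
        using C(3) by (auto simp: disjoint_family_on_def pairwise_def disjnt_def)
      fix i assume "i \<in> C"
      then obtain x h where i: "i = (x, h)" "0 < h" "\<phi> (x + h) - \<phi> (x - h) \<le> r * (2 * h)"
        using C(2) by (auto simp: K_def)
      have "emeasure \<mu> (ball x h) \<le> ennreal (r * (2 * h))"
        using \<mu>_ball[OF i(2), of x] i(3) by (meson ennreal_leI order_trans)
      then show "1 * emeasure \<mu> (ball (fst i) (snd i)) \<le> ennreal r * emeasure lborel (ball (fst i) (snd i))"
        using i r by (simp add: leb_ball ennreal_mult)
    qed (use C in auto)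
    also have "emeasure lborel W \<le> emeasure lborel U"
      using U W by (intro emeasure_mono) auto
    also have "emeasure lborel U \<le> emeasure lborel S + ennreal e"
    proof -
      have "emeasure lborel U \<le> emeasure lborel S + emeasure lborel (U - S)"
        using emeasure_subadditive[of S lborel "U - S"] U S by (simp add: Un_absorb1)
      then show ?thesis
        using U(3) by (meson add_left_mono less_imp_le order_trans)
    qed
    finally have up: "emeasure \<mu> W \<le> ennreal r * (emeasure lborel S + ennreal e)"
      by (simp add: mult_left_mono)
    \<comment> \<open>Closed balls this time: a lower bound for \<open>\<mu>\<close> is needed, and
      \<open>\<mu>_cball\<close> is an equality while \<open>\<mu>_ball\<close> only bounds from
      above.\<close>
    define K2 where "K2 = {(x, h). 0 < h \<and> cball x h \<subseteq> W \<and> R * (2 * h) \<le> \<phi> (x + h) - \<phi> (x - h)}"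
    obtain D where D: "countable D" "D \<subseteq> K2"
      "pairwise (\<lambda>i j. disjnt (cball (fst i) (snd i)) (cball (fst j) (snd j))) D"
      "negligible (S \<inter> W - (\<Union>i\<in>D. cball (fst i) (snd i)))"
    proof (rule Vitali_covering_theorem_cballs[of K2 snd "S \<inter> W" fst])
      fix x d :: real assume x: "x \<in> S \<inter> W" "0 < d"
      obtain d' where "0 < d'" "cball x d' \<subseteq> W"
        using W x by (meson open_contains_cball subsetD IntD2)
      moreover obtain h where "0 < h" "h < min d d'" "R * (2 * h) \<le> \<phi> (x + h) - \<phi> (x - h)"
        using hi[of x "min d d'"] x \<open>0 < d'\<close> by auto
      ultimately show "\<exists>i. i \<in> K2 \<and> x \<in> cball (fst i) (snd i) \<and> snd i < d"
        by (intro exI[of _ "(x, h)"]) (auto simp: K2_def)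
    next
      show "0 < snd i" if "i \<in> K2" for i
        using that by (auto simp: K2_def)
    qed blast
    define V where "V = (\<Union>i\<in>D. cball (fst i) (snd i))"
    have V: "V \<in> sets borel" "V \<subseteq> W"
      using D(1,2) by (auto simp: V_def K2_def dest!: subsetD)
    have "ennreal R * emeasure lborel V \<le> 1 * emeasure \<mu> V"
      unfolding V_def
    proof (rule emeasure_disjoint_UN_le)
      show "disjoint_family_on (\<lambda>i. cball (fst i) (snd i)) D"
        using D(3) by (auto simp: disjoint_family_on_def pairwise_def disjnt_def)
      fix i assume "i \<in> D"
      then obtain x h where i: "i = (x, h)" "0 < h" "R * (2 * h) \<le> \<phi> (x + h) - \<phi> (x - h)"
        using D(2) by (auto simp: K2_def)
      then show "ennreal R * emeasure lborel (cball (fst i) (snd i)) \<le> 1 * emeasure \<mu> (cball (fst i) (snd i))"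
        using r by (simp add: leb_ball \<mu>_cball ennreal_mult[symmetric] ennreal_leI)
    qed (use D in auto)
    also have "1 * emeasure \<mu> V \<le> emeasure \<mu> W"
      using V W by (auto intro!: emeasure_mono)
    finally have dn: "ennreal R * emeasure lborel V \<le> emeasure \<mu> W" .
    \<comment> \<open>Each covering misses only a negligible part of what it covers, so
      \<open>V\<close> has at least the full measure of \<open>S\<close>.\<close>
    have "negligible ((S - W) \<union> (S \<inter> W - V))"
      using C(4) D(4) unfolding W_def[symmetric] V_def[symmetric] by (rule negligible_Un)
    then have "negligible (S - V)"
      by (rule negligible_subset) auto
    then have "S - V \<in> null_sets lborel"
      using S V by (simp add: negligible_iff_null_sets null_sets_completion_iff)
    then have "emeasure lborel S \<le> emeasure lborel V"
      using S V emeasure_mono[of S "V \<union> (S - V)" lborel] emeasure_Un_null_set[of V lborel "S - V"] by auto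
    then show ?thesis
      using dn up by (meson mult_left_mono order_trans zero_le)
  qed
  define m where "m = measure lborel S"
  have m: "emeasure lborel S = ennreal m" "0 \<le> m"
    using S_lt by (auto simp: m_def emeasure_eq_ennreal_measure)
  have "R * m \<le> r * (m + e)" if "0 < e" for e
    using key[OF that] m that r
    by (simp add: ennreal_mult[symmetric] ennreal_plus[symmetric] del: ennreal_plus)
  then have "R * m \<le> r * m + e" if "0 < e" for e
  proof -
    have "R * m \<le> r * (m + e / r)"
      using that r by (intro \<open>\<And>e. 0 < e \<Longrightarrow> R * m \<le> r * (m + e)\<close>) auto
    then show ?thesis
      using r by (simp add: distrib_left)
  qed
  then have "R * m \<le> r * m"
    by (rule field_le_epsilon)
  then have "m = 0"
    using r m by (simp add: mult_le_cancel_right)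
  then show ?thesis
    using m S by (auto intro: null_setsI)
qed

text \<open>Where the limit fails to exist, two rationals separate the lower from the upper limit of
  the quotient. For each of the countably many pairs these points form a null set by
  \<open>symmetric_quotient_gap_null\<close>. The Lipschitz bound excludes an infinite
  limit.\<close>

lemma AE_symmetric_derivative_mono:
  fixes \<phi> :: "real \<Rightarrow> real"
  assumes mono: "mono \<phi>" and lip: "L-lipschitz_on UNIV \<phi>"
  shows "AE x in lborel. \<exists>d. ((\<lambda>h. (\<phi> (x + h) - \<phi> (x - h)) / (2 * h)) \<longlongrightarrow> d) (at_right 0)"
proof -
  define q where "q x h = (\<phi> (x + h) - \<phi> (x - h)) / (2 * h)" for x h
  have cont: "continuous_on UNIV \<phi>"
    using lip by (rule lipschitz_on_continuous_on)
  \<comment> \<open>The quotient falls below \<open>r\<close> and exceeds \<open>R\<close> at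
    arbitrarily small scales. The strict inequalities make this a countable intersection of open
    sets, hence Borel; the ball makes it bounded.\<close>
  define E where "E r R N = {x. \<forall>n::nat. (\<exists>h\<in>{0<..<1 / Suc n}. q x h < r) \<and>
      (\<exists>h\<in>{0<..<1 / Suc n}. R < q x h)} \<inter> ball 0 (real N)" for r R :: real and N :: nat
  have opn: "open {x. q x h < c}" "open {x. c < q x h}" for h c
    unfolding q_def divide_inverse
    by (intro open_Collect_less continuous_intros continuous_on_compose2[OF cont]; simp)+
  have E_null: "E r R N \<in> null_sets lborel" if "0 < r" "r < R" for r R N
  proof (rule symmetric_quotient_gap_null[OF mono cont that])
    have "E r R N = (\<Inter>n. (\<Union>h\<in>{0<..<1 / Suc n}. {x. q x h < r}) \<inter> (\<Union>h\<in>{0<..<1 / Suc n}. {x. R < q x h})) \<inter> ball 0 (real N)"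
      unfolding E_def by blast
    also have "\<dots> \<in> sets borel"
      using opn by (intro sets.Int sets.countable_INT'' borel_open open_UN) auto
    finally show "E r R N \<in> sets borel" .
    show "bounded (E r R N)"
      unfolding E_def by (rule bounded_Int) auto
    fix x d :: real assume x: "x \<in> E r R N" "0 < d"
    obtain n :: nat where n: "1 / Suc n < d"
      using x(2) by (metis nat_approx_posE)
    obtain h k where hk: "h \<in> {0<..<1 / Suc n}" "q x h < r" "k \<in> {0<..<1 / Suc n}" "R < q x k"
      using x(1) unfolding E_def by blast
    then have "0 < h" "h < d" "0 < k" "k < d"
      using n by (simp_all del: of_nat_Suc)
    moreover have "\<phi> (x + h) - \<phi> (x - h) \<le> r * (2 * h)" "R * (2 * k) \<le> \<phi> (x + k) - \<phi> (x - k)"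
      using hk(2,4) \<open>0 < h\<close> \<open>0 < k\<close> by (auto simp: q_def pos_divide_less_eq pos_less_divide_eq)
    ultimately show "\<exists>h>0. h < d \<and> \<phi> (x + h) - \<phi> (x - h) \<le> r * (2 * h)"
      "\<exists>h>0. h < d \<and> R * (2 * h) \<le> \<phi> (x + h) - \<phi> (x - h)"
      by blast+
  qed
  have "AE x in lborel. \<forall>r\<in>\<rat>. \<forall>R\<in>\<rat>. \<forall>N. 0 < r \<longrightarrow> r < R \<longrightarrow> x \<notin> E r R N"
    using E_null by (auto simp: AE_ball_countable countable_rat AE_all_countable intro!: AE_impI AE_not_in)
  then show ?thesis
  proof (eventually_elim)
    case (elim x)
    have q_nn: "0 \<le> q x h" if "0 < h" for h
      using mono that by (auto simp: q_def mono_def)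
    have q_le: "q x h \<le> L" if "0 < h" for h
    proof -
      have "\<bar>\<phi> (x + h) - \<phi> (x - h)\<bar> \<le> L * \<bar>2 * h\<bar>"
        using lipschitz_onD[OF lip, of "x + h" "x - h"] by (simp add: dist_real_def)
      then show ?thesis
        using that by (auto simp: q_def field_simps)
    qed
    let ?F = "at_right (0::real)"
    let ?q = "\<lambda>h. ereal (q x h)"
    have ev: "\<forall>\<^sub>F h in ?F. 0 < h"
      by (rule eventually_at_right_less)
    have lo: "0 \<le> Liminf ?F ?q"
      using eventually_mono[OF ev] q_nn by (intro Liminf_bounded) (auto elim!: eventually_mono)
    have hi: "Limsup ?F ?q \<le> ereal L"
      using q_le by (intro Limsup_bounded) (auto intro: eventually_mono[OF ev])
    have le: "Liminf ?F ?q \<le> Limsup ?F ?q"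
      by (rule Liminf_le_Limsup) simp
    have eq: "Liminf ?F ?q = Limsup ?F ?q"
    proof (rule ccontr)
      assume "Liminf ?F ?q \<noteq> Limsup ?F ?q"
      with le have "Liminf ?F ?q < Limsup ?F ?q" by simp
      \<comment> \<open>The reals \<open>r'\<close> and \<open>R'\<close> serve to place rationals
        \<open>r < r2\<close> strictly between the lower and the upper limit. Since
        \<open>r'\<close> exceeds the nonnegative lower limit, \<open>r\<close> is positive, as
        \<open>E_null\<close> demands.\<close>
      then obtain R' where R': "Liminf ?F ?q < ereal R'" "ereal R' < Limsup ?F ?q"
        using ereal_dense2 by blast
      obtain r' where r': "Liminf ?F ?q < ereal r'" "ereal r' < ereal R'"
        using ereal_dense2[OF R'(1)] by blast
      have "0 < r'" using r' lo by (metis ereal_less(2) order_le_less_trans)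
      obtain r where r: "r \<in> \<rat>" "r' < r" "r < R'"
        using Rats_dense_in_real r'(2) by (metis ereal_less_eq(3) not_le)
      obtain r2 where r2: "r < r2" "r2 < R'" "r2 \<in> \<rat>"
        using Rats_dense_in_real r(3) by metis
      obtain N :: nat where N: "\<bar>x\<bar> < real N"
        using reals_Archimedean2 by blast
      have freq1: "\<not> (\<forall>\<^sub>F h in ?F. r \<le> q x h)"
      proof
        assume "\<forall>\<^sub>F h in ?F. r \<le> q x h"
        then have "ereal r \<le> Liminf ?F ?q" by (intro Liminf_bounded) auto
        then have "ereal r < ereal r'" using r'(1) by (rule order.strict_trans1)
        then show False using r by simp
      qed
      have freq2: "\<not> (\<forall>\<^sub>F h in ?F. q x h \<le> r2)"
      proof
        assume "\<forall>\<^sub>F h in ?F. q x h \<le> r2"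
        then have "Limsup ?F ?q \<le> ereal r2" by (intro Limsup_bounded) auto
        with R'(2) have "ereal R' < ereal r2" by (rule order.strict_trans2)
        then show False using r2 by simp
      qed
      have "x \<in> E r r2 N"
        unfolding E_def
      proof (intro IntI CollectI allI conjI)
        fix n :: nat
        have p: "(0::real) < 1 / Suc n" by simp
        show "\<exists>h\<in>{0<..<1 / Suc n}. q x h < r"
          using freq1 p unfolding eventually_at_right_field by (metis not_le greaterThanLessThan_iff)
        show "\<exists>h\<in>{0<..<1 / Suc n}. r2 < q x h"
          using freq2 p unfolding eventually_at_right_field by (metis not_le greaterThanLessThan_iff)
      qed (use N in auto)
      then show False
        using elim r r2 \<open>0 < r'\<close> by (metis order_less_trans)
    qed
    obtain d where d: "Liminf ?F ?q = ereal d"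
      using lo order_trans[OF le hi] by (metis ereal_cases ereal_infty_less_eq(1,2) infinity_ereal_def MInfty_neq_ereal(1) PInfty_neq_ereal(2) zero_ereal_def)
    have "(?q \<longlongrightarrow> ereal d) ?F"
      using d eq by (subst tendsto_iff_Liminf_eq_Limsup) simp_all
    then show ?case
      by (auto simp: q_def)
  qed
qed

text \<open>Real and imaginary parts are treated separately. Adding \<open>L * x\<close> makes each
  of them monotone and merely shifts its symmetric quotient by the constant
  \<open>L\<close>.\<close>

lemma AE_symmetric_derivative_lipschitz:
  fixes \<Phi> :: "real \<Rightarrow> complex"
  assumes lip: "L-lipschitz_on UNIV \<Phi>"
  shows "AE x in lborel. \<exists>d. ((\<lambda>h. (\<Phi> (x + h) - \<Phi> (x - h)) /\<^sub>R (2 * h)) \<longlongrightarrow> d) (at_right 0)"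
proof -
  have L0: "0 \<le> L" using lip by (rule lipschitz_on_nonneg)
  have real_case: "AE x in lborel. \<exists>d. ((\<lambda>h. (\<phi> (x + h) - \<phi> (x - h)) / (2 * h)) \<longlongrightarrow> d) (at_right 0)"
    if \<phi>: "\<And>x y. \<bar>\<phi> x - \<phi> y\<bar> \<le> L * \<bar>x - y\<bar>" for \<phi> :: "real \<Rightarrow> real"
  proof -
    have "mono (\<lambda>x. \<phi> x + L * x)"
    proof (rule monoI)
      fix x y :: real assume "x \<le> y"
      then show "\<phi> x + L * x \<le> \<phi> y + L * y"
        using \<phi>[of x y] by (auto simp: algebra_simps abs_if split: if_splits)
    qed
    moreover have "(2 * L)-lipschitz_on UNIV (\<lambda>x. \<phi> x + L * x)"
    proof (rule lipschitz_onI)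
      fix x y :: real
      have "\<bar>\<phi> x + L * x - (\<phi> y + L * y)\<bar> \<le> \<bar>\<phi> x - \<phi> y\<bar> + \<bar>L * (x - y)\<bar>"
        by (simp add: algebra_simps)
      also have "\<dots> \<le> 2 * L * \<bar>x - y\<bar>"
        using \<phi>[of x y] L0 by (simp add: abs_mult)
      finally show "dist (\<phi> x + L * x) (\<phi> y + L * y) \<le> 2 * L * dist x y"
        by (simp add: dist_real_def)
    qed (use L0 in simp)
    ultimately have "AE x in lborel. \<exists>d. ((\<lambda>h. (\<phi> (x + h) + L * (x + h) - (\<phi> (x - h) + L * (x - h))) / (2 * h)) \<longlongrightarrow> d) (at_right 0)"
      by (rule AE_symmetric_derivative_mono)
    then show ?thesis
    proof eventually_elim
      case (elim x)
      then obtain d where d: "((\<lambda>h. (\<phi> (x + h) + L * (x + h) - (\<phi> (x - h) + L * (x - h))) / (2 * h)) \<longlongrightarrow> d) (at_right 0)"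
        by blast
      have "((\<lambda>h. (\<phi> (x + h) - \<phi> (x - h)) / (2 * h)) \<longlongrightarrow> d - L) (at_right 0)"
        by (rule Lim_transform_eventually[OF tendsto_diff[OF d tendsto_const]])
          (auto simp: field_simps eventually_at_right_field intro: exI[of _ 1])
      then show ?case by blast
    qed
  qed
  have dist: "norm (\<Phi> x - \<Phi> y) \<le> L * \<bar>x - y\<bar>" for x y
    using lipschitz_onD[OF lip, of x y] by (simp add: dist_norm)
  have "AE x in lborel. \<exists>d. ((\<lambda>h. (Re (\<Phi> (x + h)) - Re (\<Phi> (x - h))) / (2 * h)) \<longlongrightarrow> d) (at_right 0)"
    by (intro real_case) (metis abs_Re_le_cmod dist minus_complex.sel(1) order_trans)
  moreover have "AE x in lborel. \<exists>d. ((\<lambda>h. (Im (\<Phi> (x + h)) - Im (\<Phi> (x - h))) / (2 * h)) \<longlongrightarrow> d) (at_right 0)"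
    by (intro real_case) (metis abs_Im_le_cmod dist minus_complex.sel(2) order_trans)
  ultimately show ?thesis
  proof eventually_elim
    case (elim x)
    then obtain d e where
      "((\<lambda>h. (Re (\<Phi> (x + h)) - Re (\<Phi> (x - h))) / (2 * h)) \<longlongrightarrow> d) (at_right 0)"
      "((\<lambda>h. (Im (\<Phi> (x + h)) - Im (\<Phi> (x - h))) / (2 * h)) \<longlongrightarrow> e) (at_right 0)"
      by blast
    then have "((\<lambda>h. Complex ((Re (\<Phi> (x + h)) - Re (\<Phi> (x - h))) / (2 * h)) ((Im (\<Phi> (x + h)) - Im (\<Phi> (x - h))) / (2 * h)))
        \<longlongrightarrow> Complex d e) (at_right 0)"
      by (rule tendsto_Complex)
    also have "(\<lambda>h. Complex ((Re (\<Phi> (x + h)) - Re (\<Phi> (x - h))) / (2 * h)) ((Im (\<Phi> (x + h)) - Im (\<Phi> (x - h))) / (2 * h))) =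
        (\<lambda>h. (\<Phi> (x + h) - \<Phi> (x - h)) /\<^sub>R (2 * h))"
      by (intro ext complex_eqI) (simp_all only: complex.sel scaleR_complex.sel minus_complex.sel divide_inverse_commute)
    finally show ?case by blast
  qed
qed

section \<open>Boundary values of bounded holomorphic functions\<close>

text \<open>Cauchy's formula on the rectangle with corners \<open>-\<i>\<close> and
  \<open>1 + \<i>\<close>. Its left side lies on the imaginary axis and yields the Poisson kernel
  \<open>\<sigma> / (y\<^sup>2 + \<sigma>\<^sup>2)\<close>; the other three sides make up the
  error.\<close>

lemma local_poisson_formula:
  fixes h :: "complex \<Rightarrow> complex"
  assumes S: "open S" "convex S" "{w. 0 \<le> Re w} \<subseteq> S" and hol: "h holomorphic_on S"
    and M: "\<And>w. w \<in> S \<Longrightarrow> norm (h w) \<le> M" and \<sigma>: "0 < \<sigma>" "\<sigma> \<le> 1/2"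
  shows "norm (of_real pi * h (of_real \<sigma>) -
      of_real \<sigma> * integral {-1..1} (\<lambda>y. h (\<i> * of_real y) / of_real (y\<^sup>2 + \<sigma>\<^sup>2))) \<le> 16 * M * \<sigma>"
proof -
  define I where "I = integral {-1..1} (\<lambda>y. h (\<i> * of_real y) / of_real (y\<^sup>2 + \<sigma>\<^sup>2))"
  \<comment> \<open>Subtracting the Cauchy kernel of the reflected point \<open>-\<sigma>\<close> makes the kernel \<open>O(\<sigma>)\<close> on the other three sides.\<close>
  define k where "k w = h w / (w - of_real \<sigma>) - h w / (w - of_real (-\<sigma>))" for w
  let ?a = "Complex 0 (-1)" and ?b = "Complex 1 (-1)" and ?c = "Complex 1 1" and ?d = "Complex 0 1"
  have M0: "0 \<le> M"
    using M[of 0] S by (metis mem_Collect_eq norm_ge_zero order_trans subsetD zero_complex.sel(1) order_refl)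
  have img: "path_image (rectpath ?a ?c) \<subseteq> {w. 0 \<le> Re w} - {of_real \<sigma>}"
    using \<sigma> by (subst path_image_rectpath) auto
  have "((\<lambda>w. h w / (w - of_real \<sigma>)) has_contour_integral
      (2 * pi * \<i> * winding_number (rectpath ?a ?c) (of_real \<sigma>) * h (of_real \<sigma>))) (rectpath ?a ?c)"
    using S img \<sigma> hol by (intro Cauchy_integral_formula_convex_simple[of S]) (auto simp: interior_open)
  moreover have "winding_number (rectpath ?a ?c) (of_real \<sigma>) = 1"
    using \<sigma> by (intro winding_number_rectpath) (auto simp: in_box_complex_iff)
  moreover have "((\<lambda>w. h w / (w - of_real (-\<sigma>))) has_contour_integral 0) (rectpath ?a ?c)"
  \<comment> \<open>The pole \<open>-\<sigma>\<close> lies to the left of the rectangle; cutting it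
    off by a half plane keeps the domain convex.\<close>
  proof (rule Cauchy_theorem_convex_simple[of _ "S \<inter> {w. -\<sigma> < Re w}"])
    show "(\<lambda>w. h w / (w - of_real (-\<sigma>))) holomorphic_on S \<inter> {w. -\<sigma> < Re w}"
      by (intro holomorphic_intros holomorphic_on_subset[OF hol]) (auto simp: complex_eq_iff)
    show "convex (S \<inter> {w. - \<sigma> < Re w})"
      by (intro convex_Int S convex_halfspace_Re_gt)
  qed (use img S \<sigma> in auto)
  ultimately have int: "(k has_contour_integral (2 * pi * \<i> * h (of_real \<sigma>))) (rectpath ?a ?c)"
    unfolding k_def using has_contour_integral_diff by fastforce
  have cont: "continuous_on ({w. 0 \<le> Re w} - {of_real \<sigma>}) k"
    unfolding k_def using \<sigma> S
    by (intro continuous_intros continuous_on_subset[OF holomorphic_on_imp_continuous_on[OF hol]])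
      (auto simp: complex_eq_iff)
  have segs: "closed_segment ?a ?b \<subseteq> {w. 0 \<le> Re w} - {of_real \<sigma>}"
    "closed_segment ?b ?c \<subseteq> {w. 0 \<le> Re w} - {of_real \<sigma>}"
    "closed_segment ?c ?d \<subseteq> {w. 0 \<le> Re w} - {of_real \<sigma>}"
    "closed_segment ?d ?a \<subseteq> {w. 0 \<le> Re w} - {of_real \<sigma>}"
    "closed_segment ?a ?d \<subseteq> {w. 0 \<le> Re w} - {of_real \<sigma>}"
    using \<sigma> by (auto simp: closed_segment_same_Re closed_segment_same_Im closed_segment_eq_real_ivl)
  have ci: "k contour_integrable_on linepath ?a ?b" "k contour_integrable_on linepath ?b ?c"
    "k contour_integrable_on linepath ?c ?d" "k contour_integrable_on linepath ?d ?a"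
    using segs by (auto intro!: contour_integrable_continuous_linepath continuous_on_subset[OF cont])
  have "2 * pi * \<i> * h (of_real \<sigma>) = contour_integral (rectpath ?a ?c) k"
    using int by (simp add: contour_integral_unique)
  also have "\<dots> = contour_integral (linepath ?a ?b) k + contour_integral (linepath ?b ?c) k
      + contour_integral (linepath ?c ?d) k + contour_integral (linepath ?d ?a) k"
    using ci by (simp add: rectpath_def Let_def)
  also have "contour_integral (linepath ?d ?a) k = - contour_integral (linepath ?a ?d) k"
    using segs by (intro contour_integral_reverse_linepath continuous_on_subset[OF cont]) auto
  also have "contour_integral (linepath ?a ?d) k = \<i> * integral {-1..1} (\<lambda>x. k (Complex 0 x))"
    by (rule contour_integral_linepath_same_Re) auto
  also have "(\<lambda>x. k (Complex 0 x)) = (\<lambda>y. - (2 * of_real \<sigma>) * (h (\<i> * of_real y) / of_real (y\<^sup>2 + \<sigma>\<^sup>2)))"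
  proof
    fix y :: real
    have nz: "of_real (y\<^sup>2 + \<sigma>\<^sup>2) \<noteq> (0::complex)"
      using \<sigma> by (metis of_real_eq_0_iff sum_power2_eq_zero_iff less_irrefl)
    have e: "Complex 0 y = \<i> * of_real y"
      by (simp add: complex_eq_iff)
    have nz': "\<i> * of_real y - of_real \<sigma> \<noteq> 0" "\<i> * of_real y - of_real (-\<sigma>) \<noteq> 0"
      using \<sigma> by (auto simp: complex_eq_iff)
    have prod: "(\<i> * of_real y - of_real \<sigma>) * (\<i> * of_real y - of_real (-\<sigma>)) = - of_real (y\<^sup>2 + \<sigma>\<^sup>2)"
      by (simp add: algebra_simps power2_eq_square)
    have "k (Complex 0 y) = h (\<i> * of_real y) * (2 * of_real \<sigma>) /
        ((\<i> * of_real y - of_real \<sigma>) * (\<i> * of_real y - of_real (-\<sigma>)))"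
      unfolding k_def e diff_frac_eq[OF nz'] by (simp add: algebra_simps)
    also have "\<dots> = - (2 * of_real \<sigma>) * (h (\<i> * of_real y) / of_real (y\<^sup>2 + \<sigma>\<^sup>2))"
      unfolding prod by (simp only: divide_minus_right mult_minus_left mult_minus_right minus_divide_left times_divide_eq_right mult.commute)
    finally show "k (Complex 0 y) = - (2 * of_real \<sigma>) * (h (\<i> * of_real y) / of_real (y\<^sup>2 + \<sigma>\<^sup>2))" .
  qed
  also have "integral {-1..1} (\<lambda>y. - (2 * of_real \<sigma>) * (h (\<i> * of_real y) / of_real (y\<^sup>2 + \<sigma>\<^sup>2))) = - (2 * of_real \<sigma>) * I"
    unfolding I_def by (rule integral_mult_right)
  finally have "2 * \<i> * (of_real pi * h (of_real \<sigma>) -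
      of_real \<sigma> * I) =
      contour_integral (linepath ?a ?b) k + contour_integral (linepath ?b ?c) k + contour_integral (linepath ?c ?d) k"
    by (simp add: algebra_simps)
  then have "2 * norm (of_real pi * h (of_real \<sigma>) -
      of_real \<sigma> * I) =
      norm (contour_integral (linepath ?a ?b) k + contour_integral (linepath ?b ?c) k + contour_integral (linepath ?c ?d) k)"
    by (metis mult.assoc norm_ii norm_mult norm_numeral mult_1)
  also have "\<dots> \<le> norm (contour_integral (linepath ?a ?b) k) + norm (contour_integral (linepath ?b ?c) k)
      + norm (contour_integral (linepath ?c ?d) k)"
    by (meson add_right_mono norm_triangle_ineq order_trans)
  \<comment> \<open>On these sides both poles are at distance at least 1/2, and the combined
    numerator carries a factor \<open>2 * \<sigma>\<close>, hence \<open>8 * \<sigma> * M\<close>.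
    The total length is 4, and the factor 2 on the left turns 32 into the constant 16.\<close>
  also have "\<dots> \<le> 8 * \<sigma> * M * 1 + 8 * \<sigma> * M * 2 + 8 * \<sigma> * M * 1"
  proof -
    have kb: "norm (k w) \<le> 8 * \<sigma> * M" if w: "0 \<le> Re w" "1 \<le> norm w" for w
    proof -
      have n: "1/2 \<le> norm (w - of_real \<sigma>)" "1/2 \<le> norm (w - of_real (-\<sigma>))"
        using norm_triangle_ineq2[of w "of_real \<sigma>"] norm_triangle_ineq2[of w "of_real (-\<sigma>)"] w \<sigma> by auto
      then have nz: "w - of_real \<sigma> \<noteq> 0" "w - of_real (-\<sigma>) \<noteq> 0"
        by auto
      have "k w = h w * (2 * of_real \<sigma>) / ((w - of_real \<sigma>) * (w - of_real (-\<sigma>)))"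
        unfolding k_def diff_frac_eq[OF nz] by (simp add: algebra_simps)
      then have "norm (k w) = norm (h w) * (2 * \<sigma>) / (norm (w - of_real \<sigma>) * norm (w - of_real (-\<sigma>)))"
        using \<sigma> by (simp add: norm_mult norm_divide)
      also have "\<dots> \<le> M * (2 * \<sigma>) / ((1/2) * (1/2))"
        using n M0 \<sigma> M w S by (intro frac_le mult_mono mult_nonneg_nonneg) auto
      finally show ?thesis by (simp add: mult_ac)
    qed
    have one: "1 \<le> norm w" if "1 \<le> \<bar>Re w\<bar> \<or> 1 \<le> \<bar>Im w\<bar>" for w
      using that abs_Re_le_cmod[of w] abs_Im_le_cmod[of w] by linarith
    have pts: "w \<in> closed_segment ?a ?b \<union> closed_segment ?b ?c \<union> closed_segment ?c ?d \<Longrightarrow> 0 \<le> Re w \<and> 1 \<le> norm w" for w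
      using one[of w] by (auto simp: closed_segment_same_Re closed_segment_same_Im closed_segment_eq_real_ivl)
    have "norm (contour_integral (linepath u v) k) \<le> 8 * \<sigma> * M * norm (v - u)"
      if "k contour_integrable_on linepath u v" "closed_segment u v \<subseteq> closed_segment ?a ?b \<union> closed_segment ?b ?c \<union> closed_segment ?c ?d" for u v
      using that pts kb M0 \<sigma> by (intro contour_integral_bound_linepath) auto
    moreover have "norm (?b - ?a) = 1" "norm (?c - ?b) = 2" "norm (?d - ?c) = 1"
      by (simp_all add: cmod_def)
    ultimately show ?thesis
      using ci by (intro add_mono) (metis Un_upper1 Un_upper2 le_supI1)+
  qed
  finally show ?thesis
    by (simp add: I_def)
qed

text \<open>Integration by parts replaces \<open>h\<close> on the axis by its primitive
  \<open>F\<close>, which will have continuous boundary values when \<open>h\<close> need not. The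
  boundary terms at \<open>\<i>\<close> and \<open>-\<i>\<close> add \<open>2 * M * \<sigma>\<close>
  to the error, so 16 becomes 18.\<close>

lemma local_poisson_primitive:
  fixes h :: "complex \<Rightarrow> complex"
  assumes S: "open S" "convex S" "{w. 0 \<le> Re w} \<subseteq> S"
    and F: "\<And>w. w \<in> S \<Longrightarrow> (F has_field_derivative h w) (at w)"
    and M: "\<And>w. w \<in> S \<Longrightarrow> norm (h w) \<le> M" and \<sigma>: "0 < \<sigma>" "\<sigma> \<le> 1/2"
  shows "norm (of_real pi * h (of_real \<sigma>) -
      of_real \<sigma> * integral {-1..1} (\<lambda>y. F (\<i> * of_real y) / \<i> * of_real (2 * y / (y\<^sup>2 + \<sigma>\<^sup>2)\<^sup>2))) \<le> 18 * M * \<sigma>"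
proof -
  have FS: "F holomorphic_on S"
    using F by (auto simp: holomorphic_on_open[OF S(1)])
  have hol: "h holomorphic_on S"
    using holomorphic_deriv[OF FS S(1)] F by (metis (no_types, lifting) DERIV_imp_deriv holomorphic_cong)
  have M0: "0 \<le> M"
    using M[of 0] S by (metis mem_Collect_eq norm_ge_zero order_trans subsetD zero_complex.sel(1) order_refl)
  have nz: "y\<^sup>2 + \<sigma>\<^sup>2 \<noteq> 0" "0 < y\<^sup>2 + \<sigma>\<^sup>2" for y :: real
    using \<sigma> by (auto simp: add_nonneg_pos sum_power2_eq_zero_iff)
  have iS: "\<i> * of_real y \<in> S" for y
    using S by auto
  have conth: "continuous_on {-1..1} (\<lambda>y. h (\<i> * of_real y))"
    using iS by (intro continuous_on_compose2[OF holomorphic_on_imp_continuous_on[OF hol]] continuous_intros) auto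
  have contF: "continuous_on {-1..1} (\<lambda>y. F (\<i> * of_real y))"
    using iS by (intro continuous_on_compose2[OF holomorphic_on_imp_continuous_on[OF FS]] continuous_intros) auto
  have der: "((\<lambda>y. F (\<i> * of_real y) / \<i> * of_real (1 / (y\<^sup>2 + \<sigma>\<^sup>2))) has_vector_derivative
      (h (\<i> * of_real y) / of_real (y\<^sup>2 + \<sigma>\<^sup>2) - F (\<i> * of_real y) / \<i> * of_real (2 * y / (y\<^sup>2 + \<sigma>\<^sup>2)\<^sup>2))) (at y within {-1..1})" for y
  proof -
    have "((\<lambda>y. of_real (1 / (y\<^sup>2 + \<sigma>\<^sup>2)) :: complex) has_vector_derivative of_real (- (2 * y / (y\<^sup>2 + \<sigma>\<^sup>2)\<^sup>2))) (at y within {-1..1})"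
      using nz[of y] by (intro has_vector_derivative_of_real)
        (auto intro!: derivative_eq_intros simp: has_real_derivative_iff_has_vector_derivative[symmetric] power2_eq_square)
    moreover have "((\<lambda>y. F (\<i> * of_real y)) has_vector_derivative \<i> * h (\<i> * of_real y)) (at y within {-1..1})"
    proof -
      have "((\<lambda>z. F (\<i> * z)) has_field_derivative h (\<i> * of_real y) * \<i>) (at (of_real y))"
        by (rule DERIV_chain2[where f = F and g = "\<lambda>z. \<i> * z", OF F[OF iS]]) (auto intro!: derivative_eq_intros)
      then show ?thesis
        by (auto dest!: has_vector_derivative_real_field simp: mult.commute intro: has_vector_derivative_at_within)
    qed
    ultimately have "((\<lambda>y. (F (\<i> * of_real y) / \<i>) * of_real (1 / (y\<^sup>2 + \<sigma>\<^sup>2))) has_vector_derivative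
      (F (\<i> * of_real y) / \<i>) * of_real (- (2 * y / (y\<^sup>2 + \<sigma>\<^sup>2)\<^sup>2)) + (\<i> * h (\<i> * of_real y) / \<i>) * of_real (1 / (y\<^sup>2 + \<sigma>\<^sup>2))) (at y within {-1..1})"
      by (intro has_vector_derivative_mult has_vector_derivative_divide)
    then show ?thesis
      by (simp add: field_simps)
  qed
  define I where "I = integral {-1..1} (\<lambda>y. h (\<i> * of_real y) / of_real (y\<^sup>2 + \<sigma>\<^sup>2))"
  define J where "J = integral {-1..1} (\<lambda>y. F (\<i> * of_real y) / \<i> * of_real (2 * y / (y\<^sup>2 + \<sigma>\<^sup>2)\<^sup>2))"
  have iI: "(\<lambda>y. h (\<i> * of_real y) / of_real (y\<^sup>2 + \<sigma>\<^sup>2)) integrable_on {-1..1}"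
    using nz by (intro integrable_continuous_real continuous_intros conth) (metis of_real_eq_0_iff)
  have iJ: "(\<lambda>y. F (\<i> * of_real y) / \<i> * of_real (2 * y / (y\<^sup>2 + \<sigma>\<^sup>2)\<^sup>2)) integrable_on {-1..1}"
    using nz by (intro integrable_continuous_real continuous_intros contF) auto
  have "((\<lambda>y. h (\<i> * of_real y) / of_real (y\<^sup>2 + \<sigma>\<^sup>2) - F (\<i> * of_real y) / \<i> * of_real (2 * y / (y\<^sup>2 + \<sigma>\<^sup>2)\<^sup>2))
      has_integral (F (\<i> * of_real 1) / \<i> * of_real (1 / (1\<^sup>2 + \<sigma>\<^sup>2)) - F (\<i> * of_real (-1)) / \<i> * of_real (1 / ((-1)\<^sup>2 + \<sigma>\<^sup>2)))) {-1..1}"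
    by (rule fundamental_theorem_of_calculus) (use der in auto)
  then have IJ: "I - J = (F \<i> - F (-\<i>)) / \<i> * of_real (1 / (1 + \<sigma>\<^sup>2))"
    unfolding I_def J_def integral_diff[OF iI iJ, symmetric]
    by (subst integral_unique, assumption) (simp add: algebra_simps diff_divide_distrib)
  have "norm (F \<i> - F (-\<i>)) \<le> M * norm (\<i> - (-\<i>))"
  proof (rule field_differentiable_bound)
    show "convex S" by fact
    show "(F has_field_derivative h z) (at z within S)" if "z \<in> S" for z
      using F[OF that] by (rule has_field_derivative_at_within)
  qed (use M S in auto)
  then have "norm (I - J) \<le> 2 * M * 1"
    unfolding IJ norm_mult norm_divide norm_of_real
    using M0 nz(2)[of 1] by (intro mult_mono) (auto simp: divide_le_eq)
  then have "norm (of_real \<sigma> * (I - J)) \<le> 2 * M * \<sigma>"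
    using \<sigma> by (simp add: norm_mult)
  moreover have "norm (of_real pi * h (of_real \<sigma>) - of_real \<sigma> * I) \<le> 16 * M * \<sigma>"
    unfolding I_def using local_poisson_formula[OF S hol M \<sigma>] by simp
  ultimately have "norm ((of_real pi * h (of_real \<sigma>) - of_real \<sigma> * I) + of_real \<sigma> * (I - J)) \<le> 16 * M * \<sigma> + 2 * M * \<sigma>"
    by (meson add_mono norm_triangle_ineq order_trans)
  then show ?thesis
    by (simp add: J_def algebra_simps)
qed

text \<open>The translates by \<open>\<delta> > 0\<close> are holomorphic across the imaginary axis,
  so \<open>local_poisson_primitive\<close> applies to them; then \<open>\<delta>\<close> tends to
  0.\<close>

lemma boundary_poisson_primitive:
  fixes f :: "complex \<Rightarrow> complex"
  assumes F: "\<And>w. 0 < Re w \<Longrightarrow> (F has_field_derivative f w) (at w)"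
    and lip: "M-lipschitz_on {w. 0 \<le> Re w} F"
    and M: "\<And>w. 0 < Re w \<Longrightarrow> norm (f w) \<le> M" and \<sigma>: "0 < \<sigma>" "\<sigma> \<le> 1/2"
  shows "norm (of_real pi * f (of_real \<sigma>) -
      of_real \<sigma> * integral {-1..1} (\<lambda>y. F (\<i> * of_real y) / \<i> * of_real (2 * y / (y\<^sup>2 + \<sigma>\<^sup>2)\<^sup>2))) \<le> 18 * M * \<sigma>"
proof -
  define k where "k y = 2 * y / (y\<^sup>2 + \<sigma>\<^sup>2)\<^sup>2" for y :: real
  have M0: "0 \<le> M"
    using lip by (rule lipschitz_on_nonneg)
  have nz: "y\<^sup>2 + \<sigma>\<^sup>2 \<noteq> 0" "0 < y\<^sup>2 + \<sigma>\<^sup>2" for y :: real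
    using \<sigma> by (auto simp: add_nonneg_pos sum_power2_eq_zero_iff)
  have contF: "continuous_on {w. 0 \<le> Re w} F"
    using lip by (rule lipschitz_on_continuous_on)
  have contk: "continuous_on {-1..1} k"
    unfolding k_def using nz by (intro continuous_intros) auto
  then have "bounded (k ` {-1..1})"
    by (intro compact_imp_bounded compact_continuous_image) auto
  then obtain B where B: "\<And>y. y \<in> {-1..1} \<Longrightarrow> norm (k y) \<le> B"
    unfolding bounded_iff by blast
  have B0: "0 \<le> B"
    using B[of 0] by (simp add: order_trans[OF norm_ge_zero])
  define J where "J \<delta> = integral {-1..1} (\<lambda>y. F (\<i> * of_real y + of_real \<delta>) / \<i> * of_real (k y))" for \<delta> :: real
  have int: "(\<lambda>y. F (\<i> * of_real y + of_real \<delta>) / \<i> * of_real (k y)) integrable_on {-1..1}" if "0 \<le> \<delta>" for \<delta>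
    using that by (intro integrable_continuous_real continuous_intros contk continuous_on_compose2[OF contF]) auto
  \<comment> \<open>A shift by \<open>\<delta>\<close> changes \<open>F\<close> by at most
    \<open>M * \<delta>\<close>, the kernel is bounded by \<open>B\<close>, and the interval has
    length 2.\<close>
  have J_lim: "(J \<longlongrightarrow> J 0) (at_right 0)"
  proof (rule tendsto_dist_iff[THEN iffD2], rule tendsto_sandwich[where f = "\<lambda>_. 0" and h = "\<lambda>\<delta>. 2 * (M * \<delta> * B)"])
    show "\<forall>\<^sub>F \<delta> in at_right 0. dist (J \<delta>) (J 0) \<le> 2 * (M * \<delta> * B)"
      using eventually_at_right_less
    proof eventually_elim
      case (elim \<delta>)
      have "dist (J \<delta>) (J 0) = norm (integral {-1..1} (\<lambda>y. F (\<i> * of_real y + of_real \<delta>) / \<i> * of_real (k y) - F (\<i> * of_real y + of_real 0) / \<i> * of_real (k y)))"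
        unfolding dist_norm J_def using elim by (subst integral_diff[OF int int]) auto
      also have "\<dots> \<le> (M * \<delta> * B) * (1 - (-1))"
      proof (rule integral_bound)
        show "continuous_on {-1..1} (\<lambda>y. F (\<i> * of_real y + of_real \<delta>) / \<i> * of_real (k y) - F (\<i> * of_real y + of_real 0) / \<i> * of_real (k y))"
          using elim by (intro continuous_intros contk continuous_on_compose2[OF contF]) auto
        fix y :: real assume y: "y \<in> {-1..1}"
        have "norm (F (\<i> * of_real y + of_real \<delta>) - F (\<i> * of_real y + of_real 0)) \<le> M * \<delta>"
          using lipschitz_onD[OF lip, of "\<i> * of_real y + of_real \<delta>" "\<i> * of_real y + of_real 0"] elim
          by (simp add: dist_norm)
        then show "norm (F (\<i> * of_real y + of_real \<delta>) / \<i> * of_real (k y) - F (\<i> * of_real y + of_real 0) / \<i> * of_real (k y)) \<le> M * \<delta> * B"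
          unfolding left_diff_distrib[symmetric] diff_divide_distrib[symmetric] norm_mult norm_divide
          using B[OF y] M0 elim by (intro mult_mono) auto
      qed simp
      finally show ?case by simp
    qed
    show "((\<lambda>\<delta>. 2 * (M * \<delta> * B)) \<longlongrightarrow> 0) (at_right 0)"
      by (auto intro!: tendsto_eq_intros)
  qed auto
  have "isCont f (of_real \<sigma>)"
  proof -
    have "F holomorphic_on {w. 0 < Re w}"
      using F by (auto simp: holomorphic_on_open open_halfspace_Re_gt)
    then have "deriv F holomorphic_on {w. 0 < Re w}"
      by (intro holomorphic_deriv open_halfspace_Re_gt)
    moreover have "deriv F w = f w" if "w \<in> {w. 0 < Re w}" for w
      using F that by (auto intro: DERIV_imp_deriv)
    ultimately have "f holomorphic_on {w. 0 < Re w}"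
      by (metis (no_types, lifting) holomorphic_cong)
    then show ?thesis
      using \<sigma> by (intro continuous_on_interior[OF holomorphic_on_imp_continuous_on])
        (auto simp: interior_open open_halfspace_Re_gt)
  qed
  then have f_lim: "((\<lambda>\<delta>. f (of_real \<sigma> + of_real \<delta>)) \<longlongrightarrow> f (of_real \<sigma>)) (at_right 0)"
    by (rule isCont_tendsto_compose) (auto intro!: tendsto_eq_intros)
  have "((\<lambda>\<delta>. norm (of_real pi * f (of_real \<sigma> + of_real \<delta>) - of_real \<sigma> * J \<delta>)) \<longlongrightarrow>
      norm (of_real pi * f (of_real \<sigma>) - of_real \<sigma> * J 0)) (at_right 0)"
    by (intro tendsto_intros f_lim J_lim)
  moreover have "\<forall>\<^sub>F \<delta> in at_right 0. norm (of_real pi * f (of_real \<sigma> + of_real \<delta>) - of_real \<sigma> * J \<delta>) \<le> 18 * M * \<sigma>"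
    using eventually_at_right_less
  proof eventually_elim
    case (elim \<delta>)
    show ?case
      unfolding J_def k_def
    proof (rule local_poisson_primitive[where F = "\<lambda>w. F (w + of_real \<delta>)" and h = "\<lambda>w. f (w + of_real \<delta>)" and S = "{w. - \<delta> < Re w}"])
      fix w assume w: "w \<in> {w. - \<delta> < Re w}"
      show "((\<lambda>w. F (w + of_real \<delta>)) has_field_derivative f (w + of_real \<delta>)) (at w)"
        using w by (auto intro!: F simp flip: DERIV_shift)
    qed (use elim M \<sigma> in \<open>auto simp: open_halfspace_Re_gt convex_halfspace_Re_gt\<close>)
  qed
  ultimately have "norm (of_real pi * f (of_real \<sigma>) - of_real \<sigma> * J 0) \<le> 18 * M * \<sigma>"
    by (rule tendsto_upperbound) simp
  then show ?thesis
    by (simp add: J_def k_def)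
qed

text \<open>The kernel in \<open>boundary_poisson_primitive\<close> is odd, so only the symmetric
  difference of \<open>F\<close> enters. It is small compared with \<open>y\<close> near 0, which
  makes the integral small; the part away from 0 contributes a multiple of
  \<open>\<sigma>\<close>.\<close>

lemma radial_limit_zero_of_symmetric_derivative:
  fixes f :: "complex \<Rightarrow> complex"
  assumes F: "\<And>w. 0 < Re w \<Longrightarrow> (F has_field_derivative f w) (at w)"
    and lip: "M-lipschitz_on {w. 0 \<le> Re w} F"
    and M: "\<And>w. 0 < Re w \<Longrightarrow> norm (f w) \<le> M"
    and lim: "((\<lambda>h. (F (\<i> * of_real h) - F (- (\<i> * of_real h))) /\<^sub>R h) \<longlongrightarrow> 0) (at_right 0)"
  shows "((\<lambda>\<sigma>. f (of_real \<sigma>)) \<longlongrightarrow> 0) (at_right 0)"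
proof (rule tendstoI)
  fix \<epsilon> :: real assume \<epsilon>: "0 < \<epsilon>"
  have M0: "0 \<le> M"
    using lip by (rule lipschitz_on_nonneg)
  have contF: "continuous_on {w. 0 \<le> Re w} F"
    using lip by (rule lipschitz_on_continuous_on)
  define G where "G y = F (\<i> * of_real y) - F (- (\<i> * of_real y))" for y :: real
  define e where "e = \<epsilon> / 2"
  have e: "0 < e" using \<epsilon> by (simp add: e_def)
  obtain \<eta> where \<eta>: "0 < \<eta>" "\<And>y. 0 < y \<Longrightarrow> y < \<eta> \<Longrightarrow> norm (G y /\<^sub>R y) < e"
    using tendstoD[OF lim e] unfolding eventually_at_right_field G_def by auto
  \<comment> \<open>For \<open>\<bar>y\<bar> \<ge> \<eta>\<close> the Lipschitz bound
    \<open>2 * M * \<bar>y\<bar>\<close> is at most \<open>\<bar>y\<bar> * (c * y\<^sup>2)\<close>,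
    so one estimate of \<open>G\<close> holds on the whole line.\<close>
  define c where "c = 2 * M / \<eta>\<^sup>2"
  have c0: "0 \<le> c" using M0 by (simp add: c_def)
  have Gpos: "norm (G y) \<le> y * (e + c * y\<^sup>2)" if "0 < y" for y
  proof (cases "y < \<eta>")
    case True
    then have "norm (G y) \<le> y * e"
      using \<eta>(2)[OF that True] that by (simp add: field_simps)
    then show ?thesis
      using c0 that by (smt (verit) distrib_left mult_nonneg_nonneg zero_le_power2)
  next
    case False
    have "norm (G y) \<le> M * norm (\<i> * of_real y - (- (\<i> * of_real y)))"
      using lipschitz_onD[OF lip, of "\<i> * of_real y" "- (\<i> * of_real y)"] by (simp add: G_def dist_norm)
    also have "\<dots> = y * (2 * M * 1)"
      using that by (simp add: norm_mult)
    also have "\<dots> \<le> y * (2 * M * (y\<^sup>2 / \<eta>\<^sup>2))"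
      using False that \<eta>(1) M0 by (intro mult_left_mono) (auto simp: power_mono)
    also have "\<dots> \<le> y * (e + c * y\<^sup>2)"
      using that e by (intro mult_left_mono) (auto simp: c_def)
    finally show ?thesis .
  qed
  have Gbd: "norm (G y) \<le> \<bar>y\<bar> * (e + c * y\<^sup>2)" for y
  proof -
    consider "0 < y" | "y = 0" | "y < 0" by linarith
    then show ?thesis
    proof cases
      case 3
      have "norm (G y) = norm (G (-y))"
        by (simp add: G_def norm_minus_commute)
      then show ?thesis using Gpos[of "-y"] 3 by simp
    qed (use Gpos in \<open>auto simp: G_def\<close>)
  qed
  have bound: "pi * norm (f (of_real \<sigma>)) \<le> 18 * M * \<sigma> + (e * pi + 2 * c * \<sigma>)" if \<sigma>: "0 < \<sigma>" "\<sigma> \<le> 1/2" for \<sigma>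
  proof -
    have nz: "y\<^sup>2 + \<sigma>\<^sup>2 \<noteq> 0" "0 < y\<^sup>2 + \<sigma>\<^sup>2" for y :: real
      using \<sigma> by (auto simp: add_nonneg_pos sum_power2_eq_zero_iff)
    define k where "k y = 2 * y / (y\<^sup>2 + \<sigma>\<^sup>2)\<^sup>2" for y :: real
    define J where "J = integral {-1..1} (\<lambda>y. F (\<i> * of_real y) / \<i> * of_real (k y))"
    have contk: "continuous_on {-1..1} k"
      unfolding k_def using nz by (intro continuous_intros) auto
    have i1: "(\<lambda>y. F (\<i> * of_real y) / \<i> * of_real (k y)) integrable_on {-1..1}"
      by (intro integrable_continuous_real continuous_intros contk continuous_on_compose2[OF contF]) auto
    have i2: "(\<lambda>y. F (- (\<i> * of_real y)) / \<i> * of_real (k y)) integrable_on {-1..1}"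
      by (intro integrable_continuous_real continuous_intros contk continuous_on_compose2[OF contF]) auto
    \<comment> \<open>Reflecting \<open>y\<close> and using that \<open>k\<close> is odd folds
      \<open>2 * J\<close> into an integral of \<open>G\<close>.\<close>
    have "J = integral {-1..1} (\<lambda>y. F (\<i> * of_real (-y)) / \<i> * of_real (k (-y)))"
      unfolding J_def using Henstock_Kurzweil_Integration.integral_reflect_real[of 1 "-1" "\<lambda>y. F (\<i> * of_real y) / \<i> * of_real (k y)"] by simp
    also have "\<dots> = - integral {-1..1} (\<lambda>y. F (- (\<i> * of_real y)) / \<i> * of_real (k y))"
      by (simp add: k_def)
    finally have "2 * J = J - integral {-1..1} (\<lambda>y. F (- (\<i> * of_real y)) / \<i> * of_real (k y))"
      by simp
    also have "\<dots> = integral {-1..1} (\<lambda>y. G y / \<i> * of_real (k y))"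
      unfolding J_def by (subst integral_diff[OF i1 i2, symmetric]) (simp add: G_def algebra_simps diff_divide_distrib)
    finally have J2: "2 * J = integral {-1..1} (\<lambda>y. G y / \<i> * of_real (k y))" .
    have "((\<lambda>y. \<sigma> / (y\<^sup>2 + \<sigma>\<^sup>2)) has_integral (arctan (1 / \<sigma>) - arctan (-1 / \<sigma>))) {-1..1}"
    proof (rule fundamental_theorem_of_calculus)
      fix y :: real
      have "((\<lambda>y. arctan (y / \<sigma>)) has_real_derivative inverse (1 + (y / \<sigma>)\<^sup>2) * (1 / \<sigma>)) (at y within {-1..1})"
        using \<sigma> by (auto intro!: derivative_eq_intros)
      also have "inverse (1 + (y / \<sigma>)\<^sup>2) * (1 / \<sigma>) = \<sigma> / (y\<^sup>2 + \<sigma>\<^sup>2)"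
        using \<sigma> nz[of y] by (simp add: divide_simps) (simp add: algebra_simps power2_eq_square)
      finally show "((\<lambda>y. arctan (y / \<sigma>)) has_vector_derivative \<sigma> / (y\<^sup>2 + \<sigma>\<^sup>2)) (at y within {-1..1})"
        by (simp add: has_real_derivative_iff_has_vector_derivative)
    qed simp
    then have "((\<lambda>y. (2 * e / \<sigma>) * (\<sigma> / (y\<^sup>2 + \<sigma>\<^sup>2)) + 2 * c) has_integral
        ((2 * e / \<sigma>) * (arctan (1 / \<sigma>) - arctan (-1 / \<sigma>)) + (1 - (-1)) *\<^sub>R (2 * c))) {-1..1}"
      by (intro has_integral_add has_integral_mult_right has_integral_const_real[of "2 * c" "-1" 1, simplified content_real]) simp_all
    then have hi: "((\<lambda>y. 2 * e / (y\<^sup>2 + \<sigma>\<^sup>2) + 2 * c) has_integral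
        ((2 * e / \<sigma>) * (arctan (1 / \<sigma>) - arctan (-1 / \<sigma>)) + 4 * c)) {-1..1}"
      using \<sigma> by simp
    \<comment> \<open>The \<open>e\<close> part is a multiple of the Poisson kernel, whose
      arctangent primitive varies by at most \<open>pi\<close>; the \<open>c\<close> part is bounded
      by a constant. After multiplication by \<open>\<sigma>\<close> the first stays below
      \<open>e * pi\<close> and the second is O(\<open>\<sigma>\<close>).\<close>
    have "norm (2 * J) \<le> integral {-1..1} (\<lambda>y. 2 * e / (y\<^sup>2 + \<sigma>\<^sup>2) + 2 * c)"
      unfolding J2
    proof (rule integral_norm_bound_integral)
      have "continuous_on {-1..1} G"
        unfolding G_def by (intro continuous_intros continuous_on_compose2[OF contF]) auto
      then show "(\<lambda>y. G y / \<i> * of_real (k y)) integrable_on {-1..1}"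
        by (intro integrable_continuous_real continuous_intros contk) auto
      show "(\<lambda>y. 2 * e / (y\<^sup>2 + \<sigma>\<^sup>2) + 2 * c) integrable_on {-1..1}"
        using hi by blast
      fix y :: real
      have "norm (G y / \<i> * of_real (k y)) = norm (G y) * \<bar>k y\<bar>"
        by (simp add: norm_mult norm_divide)
      also have "\<dots> \<le> (\<bar>y\<bar> * (e + c * y\<^sup>2)) * \<bar>k y\<bar>"
        by (intro mult_right_mono Gbd) auto
      also have "\<dots> = (\<bar>y\<bar> * \<bar>y\<bar>) * (2 * (e + c * y\<^sup>2)) / (y\<^sup>2 + \<sigma>\<^sup>2)\<^sup>2"
        by (simp add: k_def abs_mult mult_ac)
      also have "\<dots> = 2 * e * (y\<^sup>2 / (y\<^sup>2 + \<sigma>\<^sup>2)\<^sup>2) + 2 * c * (y\<^sup>2 / (y\<^sup>2 + \<sigma>\<^sup>2))\<^sup>2"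
        unfolding abs_mult_self_eq power2_eq_square[of y, symmetric] power_divide
        by (simp add: add_divide_distrib distrib_left power2_eq_square[of "y\<^sup>2"] mult_ac)
      also have "\<dots> \<le> 2 * e * (1 / (y\<^sup>2 + \<sigma>\<^sup>2)) + 2 * c * 1"
      proof (intro add_mono mult_left_mono)
        have *: "y\<^sup>2 / (y\<^sup>2 + \<sigma>\<^sup>2) \<le> 1"
          using nz[of y] by (simp add: divide_le_eq)
        have "y\<^sup>2 / (y\<^sup>2 + \<sigma>\<^sup>2)\<^sup>2 = (y\<^sup>2 / (y\<^sup>2 + \<sigma>\<^sup>2)) * (1 / (y\<^sup>2 + \<sigma>\<^sup>2))"
          by (simp add: power2_eq_square[of "y\<^sup>2 + \<sigma>\<^sup>2"])
        also have "\<dots> \<le> 1 * (1 / (y\<^sup>2 + \<sigma>\<^sup>2))"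
          using * nz[of y] by (intro mult_right_mono) auto
        finally show "y\<^sup>2 / (y\<^sup>2 + \<sigma>\<^sup>2)\<^sup>2 \<le> 1 / (y\<^sup>2 + \<sigma>\<^sup>2)" by simp
        show "(y\<^sup>2 / (y\<^sup>2 + \<sigma>\<^sup>2))\<^sup>2 \<le> 1"
          using * nz[of y] by (intro power_le_one) auto
      qed (use e c0 in auto)
      finally show "norm (G y / \<i> * of_real (k y)) \<le> 2 * e / (y\<^sup>2 + \<sigma>\<^sup>2) + 2 * c" by simp
    qed
    also have "\<dots> = (2 * e / \<sigma>) * (arctan (1 / \<sigma>) - arctan (-1 / \<sigma>)) + 4 * c"
      using hi by (rule integral_unique)
    also have "\<dots> \<le> (2 * e / \<sigma>) * pi + 4 * c"
    proof -
      have "arctan (1 / \<sigma>) - arctan (-1 / \<sigma>) \<le> pi"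
        using arctan_ubound[of "1 / \<sigma>"] arctan_lbound[of "-1 / \<sigma>"] by linarith
      then show ?thesis
        using e \<sigma> by (intro add_right_mono mult_left_mono) auto
    qed
    finally have "\<sigma> * norm J \<le> \<sigma> * ((e / \<sigma>) * pi + 2 * c)"
      using \<sigma> by (intro mult_left_mono) (auto simp: norm_mult)
    also have "\<dots> = e * pi + 2 * c * \<sigma>"
      using \<sigma> by (simp add: field_simps)
    finally have sJ: "norm (of_real \<sigma> * J) \<le> e * pi + 2 * c * \<sigma>"
      using \<sigma> by (simp add: norm_mult)
    have "norm (of_real pi * f (of_real \<sigma>) - of_real \<sigma> * J) \<le> 18 * M * \<sigma>"
      unfolding J_def k_def using F lip M \<sigma> by (rule boundary_poisson_primitive)
    then have "norm ((of_real pi * f (of_real \<sigma>) - of_real \<sigma> * J) + of_real \<sigma> * J) \<le> 18 * M * \<sigma> + (e * pi + 2 * c * \<sigma>)"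
      using sJ by (meson add_mono norm_triangle_ineq order_trans)
    then show ?thesis
      by (simp add: norm_mult)
  qed
  have "((\<lambda>\<sigma>. 18 * M * \<sigma> + (e * pi + 2 * c * \<sigma>)) \<longlongrightarrow> 18 * M * 0 + (e * pi + 2 * c * 0)) (at_right 0)"
    by (intro tendsto_intros)
  moreover have "18 * M * 0 + (e * pi + 2 * c * 0) < \<epsilon> * pi"
    using \<epsilon> by (simp add: e_def)
  ultimately have "\<forall>\<^sub>F \<sigma> in at_right 0. 18 * M * \<sigma> + (e * pi + 2 * c * \<sigma>) < \<epsilon> * pi"
    by (rule order_tendstoD)
  moreover have "\<forall>\<^sub>F \<sigma> in at_right 0. 0 < \<sigma> \<and> \<sigma> \<le> (1/2::real)"
    by (auto simp: eventually_at_right_field intro!: exI[of _ "1/2"])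
  ultimately show "\<forall>\<^sub>F \<sigma> in at_right 0. dist (f (of_real \<sigma>)) 0 < \<epsilon>"
  proof eventually_elim
    case (elim \<sigma>)
    then have "pi * norm (f (of_real \<sigma>)) < \<epsilon> * pi"
      by (metis bound order.strict_trans1)
    then show ?case
      by (simp add: mult.commute[of \<epsilon>])
  qed
qed

text \<open>A primitive of the bounded \<open>f\<close> is Lipschitz and so has a symmetric
  derivative at almost every boundary point. At such a point, subtracting a linear function makes
  that derivative 0, and the radial limit lemma applies.\<close>

theorem Fatou_half_plane:
  fixes f :: "complex \<Rightarrow> complex"
  assumes hol: "f holomorphic_on {s. 0 < Re s}" and bdd: "bounded (f ` {s. 0 < Re s})"
  shows "AE \<tau> in lborel. \<exists>l. ((\<lambda>\<sigma>. f (Complex \<sigma> \<tau>)) \<longlongrightarrow> l) (at_right 0)"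
proof -
  let ?H = "{s. 0 < Re s}"
  obtain M where M: "\<And>w. 0 < Re w \<Longrightarrow> norm (f w) \<le> M"
    using bdd by (auto simp: bounded_iff)
  have M0: "0 \<le> M"
    using M[of 1] by (simp add: order_trans[OF norm_ge_zero])
  obtain F0 where F0: "\<And>w. w \<in> ?H \<Longrightarrow> (F0 has_field_derivative f w) (at w within ?H)"
    using holomorphic_convex_primitive'[OF convex_halfspace_Re_gt open_halfspace_Re_gt hol] by blast
  have "M-lipschitz_on ?H F0"
  proof (rule lipschitz_onI)
    fix x y assume "x \<in> ?H" "y \<in> ?H"
    then show "dist (F0 x) (F0 y) \<le> M * dist x y"
      unfolding dist_norm using M
      by (intro field_differentiable_bound[OF convex_halfspace_Re_gt[of 0] F0]) auto
  qed (rule M0)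
  \<comment> \<open>\<open>F0\<close> is controlled only on the open half plane; the Lipschitz
    extension supplies values on the imaginary axis.\<close>
  then obtain F where F: "M-lipschitz_on (closure ?H) F" "\<And>w. w \<in> ?H \<Longrightarrow> F w = F0 w"
    using lipschitz_extend_closure by metis
  have clos: "closure ?H = {s. 0 \<le> Re s}"
    using closure_halfspace_gt[of "1::complex" 0] by (simp add: inner_complex_def)
  have lip: "M-lipschitz_on {s. 0 \<le> Re s} F"
    using F(1) clos by simp
  have dF: "(F has_field_derivative f w) (at w)" if "0 < Re w" for w
  proof -
    have "(F0 has_field_derivative f w) (at w)"
      using F0[of w] that at_within_open[of w ?H] open_halfspace_Re_gt by simp
    then show ?thesis
      using that F(2) open_halfspace_Re_gt[of 0]
      by (intro has_field_derivative_transform_within_open[of F0 _ _ ?H F]) auto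
  qed
  have "M-lipschitz_on UNIV (\<lambda>t. F (\<i> * of_real t))"
  proof (rule lipschitz_onI)
    fix s t :: real
    have "dist (F (\<i> * of_real s)) (F (\<i> * of_real t)) \<le> M * dist (\<i> * of_real s) (\<i> * of_real t)"
      by (rule lipschitz_onD[OF lip]) auto
    also have "dist (\<i> * of_real s) (\<i> * of_real t :: complex) = dist s t"
      by (simp add: dist_norm norm_mult flip: right_diff_distrib of_real_diff)
    finally show "dist (F (\<i> * of_real s)) (F (\<i> * of_real t)) \<le> M * dist s t" .
  qed (rule M0)
  then have "AE x in lborel. \<exists>d. ((\<lambda>h. (F (\<i> * of_real (x + h)) - F (\<i> * of_real (x - h))) /\<^sub>R (2 * h)) \<longlongrightarrow> d) (at_right 0)"
    by (rule AE_symmetric_derivative_lipschitz)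
  then show ?thesis
  proof eventually_elim
    case (elim x)
    then obtain d where d: "((\<lambda>h. (F (\<i> * of_real (x + h)) - F (\<i> * of_real (x - h))) /\<^sub>R (2 * h)) \<longlongrightarrow> d) (at_right 0)"
      by blast
    \<comment> \<open>Along the imaginary axis the derivative of a primitive of \<open>f\<close> is
      \<open>\<i> * f\<close>, so \<open>d / \<i>\<close> is the candidate for the limit of
      \<open>f\<close>.\<close>
    define c where "c = d / \<i>"
    define E where "E w = F (w + \<i> * of_real x) - c * w" for w
    have "((\<lambda>\<sigma>. f (of_real \<sigma> + \<i> * of_real x) - c) \<longlongrightarrow> 0) (at_right 0)"
    proof (rule radial_limit_zero_of_symmetric_derivative[where F = E and M = "M + norm c"])
      fix w :: complex assume w: "0 < Re w"
      show "(E has_field_derivative f (w + \<i> * of_real x) - c) (at w)"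
        unfolding E_def
        using w by (auto intro!: derivative_eq_intros dF simp flip: DERIV_shift)
      show "norm (f (w + \<i> * of_real x) - c) \<le> M + norm c"
        using M[of "w + \<i> * of_real x"] w norm_triangle_ineq4[of "f (w + \<i> * of_real x)" c] by simp
    next
      show "(M + norm c)-lipschitz_on {w. 0 \<le> Re w} E"
      proof (rule lipschitz_onI)
        fix u v :: complex assume uv: "u \<in> {w. 0 \<le> Re w}" "v \<in> {w. 0 \<le> Re w}"
        have "dist (E u) (E v) \<le> norm (F (u + \<i> * of_real x) - F (v + \<i> * of_real x)) + norm (c * (u - v))"
          unfolding dist_norm E_def
          by (rule order_trans[OF _ norm_triangle_ineq4]) (simp add: algebra_simps)
        also have "\<dots> \<le> M * dist u v + norm c * dist u v"
          using lipschitz_onD[OF lip, of "u + \<i> * of_real x" "v + \<i> * of_real x"] uv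
          by (simp add: dist_norm norm_mult)
        finally show "dist (E u) (E v) \<le> (M + norm c) * dist u v"
          by (simp add: distrib_right)
      qed (use M0 in auto)
      \<comment> \<open>The symmetric derivative divides by \<open>2 * h\<close>, the radial limit
        lemma by \<open>h\<close>; hence the factor 2.\<close>
      have "((\<lambda>h. 2 * ((F (\<i> * of_real (x + h)) - F (\<i> * of_real (x - h))) /\<^sub>R (2 * h)) - 2 * d) \<longlongrightarrow> 2 * d - 2 * d) (at_right 0)"
        by (intro tendsto_intros d)
      moreover have "\<forall>\<^sub>F h in at_right 0. 2 * ((F (\<i> * of_real (x + h)) - F (\<i> * of_real (x - h))) /\<^sub>R (2 * h)) - 2 * d =
          (E (\<i> * of_real h) - E (- (\<i> * of_real h))) /\<^sub>R h"
        using eventually_at_right_less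
      proof eventually_elim
        case (elim h)
        have "E (\<i> * of_real h) - E (- (\<i> * of_real h)) = (F (\<i> * of_real (x + h)) - F (\<i> * of_real (x - h))) - (2 * of_real h) * d"
          by (simp add: E_def c_def algebra_simps)
        then show ?case
          using elim by (simp only:) (simp add: scaleR_conv_of_real field_simps)
      qed
      ultimately show "((\<lambda>h. (E (\<i> * of_real h) - E (- (\<i> * of_real h))) /\<^sub>R h) \<longlongrightarrow> 0) (at_right 0)"
        by (auto intro: Lim_transform_eventually)
    qed
    then have "((\<lambda>\<sigma>. f (of_real \<sigma> + \<i> * of_real x)) \<longlongrightarrow> c) (at_right 0)"
      by (simp add: LIM_zero_iff)
    then show ?case
      by (auto simp: Complex_eq)
  qed
qed

section \<open>Decay of Dirichlet series\<close>

text \<open>Far to the right the terms with n at least 2 are together of order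
  \<open>2 powr (- Re s)\<close>; elsewhere the weight is bounded and \<open>f\<close> is bounded.
  Of the exponential decay only this quadratic weight is kept, since it already makes the later
  integral over \<open>\<sigma>\<close> converge.\<close>

lemma Hinf_dirichlet_decay:
  assumes "Hinf_dirichlet f a"
  obtains C where "0 < C" "\<And>s. 0 < Re s \<Longrightarrow> norm (f s - a 1) * (1 + (Re s)\<^sup>2) \<le> C"
proof -
  obtain M where M: "\<And>s. 0 < Re s \<Longrightarrow> norm (f s) \<le> M"
    using assms by (auto simp: Hinf_dirichlet_def bounded_iff halfplane_def)
  have M0: "0 \<le> M"
    using M[of 1] by (simp add: order_trans[OF norm_ge_zero])
  obtain \<kappa> where \<kappa>: "0 < \<kappa>" and
    sums: "\<And>s. \<kappa> < Re s \<Longrightarrow> (\<lambda>n. a (Suc n) * of_nat (Suc n) powr (- s)) sums f s"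
    using assms by (auto simp: Hinf_dirichlet_def halfplane_def)
  have npow: "norm (of_nat (Suc n) powr (- s) :: complex) = real (Suc n) powr (- Re s)" for n s
    using norm_powr_real_powr[of "of_nat (Suc n)" "- s"] by simp
  \<comment> \<open>The terms of the convergent series at \<open>\<kappa> + 1\<close> are bounded,
    which gives polynomial growth of the coefficients.\<close>
  have "(\<lambda>n. a (Suc n) * of_nat (Suc n) powr (- of_real (\<kappa> + 1))) \<longlonglongrightarrow> 0"
    using sums[of "of_real (\<kappa> + 1)"] by (intro summable_LIMSEQ_zero) (auto simp: sums_iff)
  then have "Bseq (\<lambda>n. a (Suc n) * of_nat (Suc n) powr (- of_real (\<kappa> + 1)))"
    by (intro convergent_imp_Bseq convergentI)
  then obtain B where B: "0 < B" "\<And>n. norm (a (Suc n) * of_nat (Suc n) powr (- of_real (\<kappa> + 1))) \<le> B"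
    by (auto simp: Bseq_def)
  have aB: "norm (a (Suc n)) \<le> B * real (Suc n) powr (\<kappa> + 1)" for n
  proof -
    have "norm (a (Suc n)) * real (Suc n) powr (- (\<kappa> + 1)) \<le> B"
      using B(2)[of n] unfolding norm_mult npow by simp
    then show ?thesis
      unfolding powr_minus_divide by (simp add: divide_le_eq)
  qed
  define Z where "Z = (\<Sum>n. 1 / real (Suc (Suc n)) ^ 2)"
  have Z_sum: "summable (\<lambda>n. 1 / real (Suc (Suc n)) ^ 2)"
    using inverse_power_summable[of 2, where ?'a = real, THEN summable_ignore_initial_segment, of 2]
    by (simp add: inverse_eq_divide power_one_over)
  have Z0: "0 \<le> Z"
    unfolding Z_def by (intro suminf_nonneg Z_sum) auto
  \<comment> \<open>Beyond \<open>\<kappa> + 3\<close> the n-th term is at most \<open>B\<close>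
    times \<open>n powr (\<kappa> + 3 - Re s)\<close> times \<open>n powr (-2)\<close>. The first
    exponent is not positive, so its base may be replaced by 2, and the second factor sums to
    \<open>Z\<close>.\<close>
  have far: "norm (f s - a 1) \<le> B * Z * 2 powr (\<kappa> + 3 - Re s)" if s: "\<kappa> + 3 \<le> Re s" for s
  proof -
    let ?t = "\<lambda>n. a (Suc n) * of_nat (Suc n) powr (- s)"
    have "?t sums f s"
      using s by (intro sums) auto
    then have "(\<lambda>n. ?t (Suc n)) sums (f s - ?t 0)"
      by (subst sums_Suc_iff) simp
    then have sum: "(\<lambda>n. ?t (Suc n)) sums (f s - a 1)"
      by simp
    have le: "norm (?t (Suc n)) \<le> (B * 2 powr (\<kappa> + 3 - Re s)) * (1 / real (Suc (Suc n)) ^ 2)" for n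
    proof -
      define m where "m = real (Suc (Suc n))"
      have m: "2 \<le> m" by (simp add: m_def)
      have "norm (?t (Suc n)) \<le> B * m powr (\<kappa> + 1) * m powr (- Re s)"
        unfolding norm_mult npow m_def by (intro mult_right_mono aB) auto
      also have "\<dots> = B * m powr (\<kappa> + 3 - Re s) * m powr (-2)"
        using m by (simp add: powr_add[symmetric] algebra_simps)
      also have "\<dots> \<le> B * 2 powr (\<kappa> + 3 - Re s) * m powr (-2)"
        using m s B by (intro mult_right_mono mult_left_mono powr_mono2') auto
      also have "m powr (-2) = 1 / m ^ 2"
        using m by (simp add: powr_minus_divide)
      finally show ?thesis by (simp add: m_def)
    qed
    have "norm (\<Sum>n. ?t (Suc n)) \<le> (\<Sum>n. (B * 2 powr (\<kappa> + 3 - Re s)) * (1 / real (Suc (Suc n)) ^ 2))"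
      by (rule norm_suminf_le[OF le]) (rule summable_mult[OF Z_sum])
    also have "\<dots> = (B * 2 powr (\<kappa> + 3 - Re s)) * Z"
      unfolding Z_def by (rule suminf_mult[OF Z_sum])
    also have "(\<Sum>n. ?t (Suc n)) = f s - a 1"
      using sum by (simp add: sums_iff)
    finally show ?thesis
      by (simp add: mult_ac)
  qed
  \<comment> \<open>With \<open>y = x * ln 2 \<ge> x / 2\<close>, \<open>1 + x\<^sup>2\<close> is at
    most \<open>1 + 4 * y\<^sup>2\<close>, and \<open>exp y \<ge> 1 + y\<^sup>2 / 2\<close> gives
    the constant 9.\<close>
  have exp_bd: "2 powr (- x) * (1 + x\<^sup>2) \<le> 9" if "0 \<le> x" for x :: real
  proof -
    define y where "y = x * ln 2"
    have "x * (1 / 2) \<le> x * ln 2"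
      using that ln2_ge_two_thirds by (intro mult_left_mono) auto
    then have "(x / 2)\<^sup>2 \<le> y\<^sup>2"
      using that by (intro power_mono) (auto simp: y_def)
    moreover have "1 + y + y\<^sup>2 / 2 \<le> exp y" "0 \<le> y"
      using that by (auto intro!: exp_lower_Taylor_quadratic simp: y_def)
    moreover have "(x / 2)\<^sup>2 = x\<^sup>2 / 4"
      by (simp add: power_divide)
    ultimately have "1 + x\<^sup>2 \<le> 9 * exp y"
      using zero_le_power2[of y] by linarith
    then show ?thesis
      by (simp add: powr_def exp_minus field_simps y_def[symmetric] mult.commute[of "ln 2"])
  qed
  \<comment> \<open>One summand for each of the two ranges of \<open>Re s\<close>; the final 1 makes
    \<open>C\<close> positive.\<close>
  define C where "C = B * Z * 2 powr (\<kappa> + 3) * 9 + (M + norm (a 1)) * (1 + (\<kappa> + 3)\<^sup>2) + 1"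
  have p1: "0 \<le> B * Z * 2 powr (\<kappa> + 3) * 9" and p2: "0 \<le> (M + norm (a 1)) * (1 + (\<kappa> + 3)\<^sup>2)"
    using B Z0 M0 by auto
  show ?thesis
  proof
    show "0 < C" unfolding C_def using p1 p2 by linarith
    fix s assume s: "0 < Re s"
    show "norm (f s - a 1) * (1 + (Re s)\<^sup>2) \<le> C"
    proof (cases "\<kappa> + 3 \<le> Re s")
      case True
      have "norm (f s - a 1) * (1 + (Re s)\<^sup>2) \<le> B * Z * 2 powr (\<kappa> + 3 - Re s) * (1 + (Re s)\<^sup>2)"
        using far[OF True] by (intro mult_right_mono) auto
      also have "\<dots> = B * Z * 2 powr (\<kappa> + 3) * (2 powr (- Re s) * (1 + (Re s)\<^sup>2))"
        by (simp add: powr_diff powr_minus_divide)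
      also have "\<dots> \<le> B * Z * 2 powr (\<kappa> + 3) * 9"
        using exp_bd[of "Re s"] s B Z0 by (intro mult_left_mono) auto
      finally show ?thesis unfolding C_def using p2 by linarith
    next
      case False
      have "norm (f s - a 1) \<le> M + norm (a 1)"
        using M[OF s] norm_triangle_ineq4[of "f s" "a 1"] by linarith
      then have "norm (f s - a 1) * (1 + (Re s)\<^sup>2) \<le> (M + norm (a 1)) * (1 + (\<kappa> + 3)\<^sup>2)"
        using False s M0 by (intro mult_mono add_left_mono power_mono) auto
      then show ?thesis unfolding C_def using p1 by linarith
    qed
  qed
qed

text \<open>Cauchy's estimate for \<open>f - c\<close> on the disc of radius \<open>Re s / 2\<close>
  about \<open>s\<close>. There real parts are at least \<open>Re s / 2\<close>, so the weight drops
  by a factor of at most 4; the radius contributes the factor 2.\<close>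

lemma deriv_decay_half_plane:
  assumes hol: "f holomorphic_on {s. 0 < Re s}"
    and C: "\<And>s. 0 < Re s \<Longrightarrow> norm (f s - c) * (1 + (Re s)\<^sup>2) \<le> C" and s: "0 < Re s"
  shows "norm (deriv f s) * (Re s * (1 + (Re s)\<^sup>2)) \<le> 8 * C"
proof -
  define x where "x = Re s"
  have x: "0 < x" using s by (simp add: x_def)
  have C0: "0 \<le> C"
    using C[OF s] by (meson add_nonneg_nonneg mult_nonneg_nonneg norm_ge_zero order_trans zero_le_one zero_le_power2)
  have Re_ge: "x / 2 \<le> Re w" if "norm (s - w) \<le> x / 2" for w
    using abs_Re_le_cmod[of "s - w"] that by (auto simp: x_def)
  have sub: "cball s (x / 2) \<subseteq> {s. 0 < Re s}"
    using Re_ge x by (force simp: dist_norm)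
  have holc: "(\<lambda>w. f w - c) holomorphic_on {s. 0 < Re s}"
    by (intro holomorphic_intros hol)
  have "norm ((deriv ^^ 1) (\<lambda>w. f w - c) s) \<le> fact 1 * (4 * C / (1 + x\<^sup>2)) / (x / 2) ^ 1"
  proof (rule Cauchy_inequality)
    show "(\<lambda>w. f w - c) holomorphic_on ball s (x / 2)"
      using sub by (intro holomorphic_on_subset[OF holc]) (meson ball_subset_cball order_trans)
    show "continuous_on (cball s (x / 2)) (\<lambda>w. f w - c)"
      using sub by (intro holomorphic_on_imp_continuous_on holomorphic_on_subset[OF holc])
    fix w assume "norm (s - w) = x / 2"
    then have w: "x / 2 \<le> Re w"
      by (intro Re_ge) simp
    then have w2: "(x / 2)\<^sup>2 \<le> (Re w)\<^sup>2"
      using x by (intro power_mono) auto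
    have "norm (f w - c) * ((1 + x\<^sup>2) / 4) \<le> norm (f w - c) * (1 + (Re w)\<^sup>2)"
      using w2 by (intro mult_left_mono) (auto simp: power_divide)
    also have "\<dots> \<le> C"
      using w x by (intro C) auto
    finally show "norm (f w - c) \<le> 4 * C / (1 + x\<^sup>2)"
      by (simp add: pos_le_divide_eq add_pos_nonneg mult.commute)
  qed (use x in auto)
  moreover have "deriv (\<lambda>w. f w - c) s = deriv f s"
    using hol s open_halfspace_Re_gt by (subst deriv_diff) (auto intro!: holomorphic_on_imp_differentiable_at)
  ultimately have "norm (deriv f s) \<le> 8 * C / (x * (1 + x\<^sup>2))"
    by (simp add: field_simps)
  then show ?thesis
    using x by (simp add: pos_le_divide_eq add_pos_nonneg x_def)
qed

section \<open>Green's formula for the smoothed power\<close>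

text \<open>
  \<open>reg_deriv\<close> and \<open>reg_deriv2\<close> are the first and second derivatives of \<open>reg_powr p \<epsilon>\<close> along a curve
  with position \<open>w\<close>, velocity \<open>v\<close> and acceleration \<open>u\<close>.
\<close>

definition reg_powr :: "real \<Rightarrow> real \<Rightarrow> complex \<Rightarrow> real" where
  "reg_powr p \<epsilon> w = ((norm w)\<^sup>2 + \<epsilon>) powr (p / 2)"

definition reg_deriv :: "real \<Rightarrow> real \<Rightarrow> complex \<Rightarrow> complex \<Rightarrow> real" where
  "reg_deriv p \<epsilon> w v = p * (((norm w)\<^sup>2 + \<epsilon>) powr (p / 2 - 1) * (w \<bullet> v))"

definition reg_deriv2 :: "real \<Rightarrow> real \<Rightarrow> complex \<Rightarrow> complex \<Rightarrow> complex \<Rightarrow> real" where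
  "reg_deriv2 p \<epsilon> w v u = p * ((p - 2) * ((norm w)\<^sup>2 + \<epsilon>) powr (p / 2 - 2) * (w \<bullet> v)\<^sup>2
     + ((norm w)\<^sup>2 + \<epsilon>) powr (p / 2 - 1) * ((norm v)\<^sup>2 + w \<bullet> u))"

text \<open>For holomorphic \<open>f\<close> this is the Laplacian of
  \<open>reg_powr p \<epsilon>\<close> along \<open>f\<close>, where \<open>w\<close> is the value
  and \<open>v\<close> the derivative; see \<open>reg_laplacian_eq\<close>.\<close>

definition reg_laplacian :: "real \<Rightarrow> real \<Rightarrow> complex \<Rightarrow> complex \<Rightarrow> real" where
  "reg_laplacian p \<epsilon> w v = p * ((norm w)\<^sup>2 + \<epsilon>) powr (p / 2 - 2) * (norm v)\<^sup>2 * (p * (norm w)\<^sup>2 + 2 * \<epsilon>)"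

lemma has_derivative_normsq_powr:
  fixes g :: "real \<Rightarrow> complex"
  assumes g: "(g has_vector_derivative g') (at x within S)" and \<epsilon>: "0 < \<epsilon>"
  shows "((\<lambda>x. ((norm (g x))\<^sup>2 + \<epsilon>) powr q) has_real_derivative
    2 * q * ((norm (g x))\<^sup>2 + \<epsilon>) powr (q - 1) * (g x \<bullet> g')) (at x within S)"
proof -
  have "((\<lambda>x. g x \<bullet> g x) has_vector_derivative (g x \<bullet> g' + g' \<bullet> g x)) (at x within S)"
    by (rule bounded_bilinear.has_vector_derivative[OF bounded_bilinear_inner g g])
  then have "((\<lambda>x. (norm (g x))\<^sup>2) has_real_derivative 2 * (g x \<bullet> g')) (at x within S)"
    by (simp add: has_real_derivative_iff_has_vector_derivative power2_norm_eq_inner inner_commute)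
  then have V: "((\<lambda>x. (norm (g x))\<^sup>2 + \<epsilon>) has_real_derivative 2 * (g x \<bullet> g')) (at x within S)"
    using DERIV_add[OF _ DERIV_const] by fastforce
  have pos: "0 < (norm (g x))\<^sup>2 + \<epsilon>"
    using \<epsilon> by (simp add: add_nonneg_pos)
  show ?thesis
    using DERIV_chain2[OF has_real_derivative_powr[OF pos] V, of q] by (simp add: mult_ac)
qed

lemma reg_powr_has_derivative:
  assumes "(g has_vector_derivative g') (at x within S)" "0 < \<epsilon>"
  shows "((\<lambda>x. reg_powr p \<epsilon> (g x)) has_real_derivative reg_deriv p \<epsilon> (g x) g') (at x within S)"
  unfolding reg_powr_def reg_deriv_def
  using has_derivative_normsq_powr[OF assms, of "p / 2"] by (simp add: mult.assoc)

lemma reg_deriv_has_derivative: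
  assumes g: "(g has_vector_derivative v x) (at x within S)" and v: "(v has_vector_derivative u) (at x within S)"
    and \<epsilon>: "0 < \<epsilon>"
  shows "((\<lambda>x. reg_deriv p \<epsilon> (g x) (v x)) has_real_derivative reg_deriv2 p \<epsilon> (g x) (v x) u) (at x within S)"
proof -
  have "((\<lambda>x. g x \<bullet> v x) has_vector_derivative (g x \<bullet> u + v x \<bullet> v x)) (at x within S)"
    by (rule bounded_bilinear.has_vector_derivative[OF bounded_bilinear_inner g v])
  then have "((\<lambda>x. g x \<bullet> v x) has_real_derivative ((norm (v x))\<^sup>2 + g x \<bullet> u)) (at x within S)"
    by (simp add: has_real_derivative_iff_has_vector_derivative power2_norm_eq_inner add.commute)
  from DERIV_cmult[OF DERIV_mult[OF has_derivative_normsq_powr[OF g \<epsilon>, of "p / 2 - 1"] this], of p]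
  show ?thesis
    unfolding reg_deriv_def reg_deriv2_def
    by (rule DERIV_cong) (simp add: algebra_simps power2_eq_square)
qed

text \<open>A holomorphic function has velocity \<open>v\<close> and acceleration \<open>u\<close>
  horizontally, \<open>\<i> * v\<close> and \<open>- u\<close> vertically. The accelerations cancel,
  and the squared inner products add up to the product of the squared norms.\<close>

lemma reg_laplacian_eq:
  assumes "0 < \<epsilon>"
  shows "reg_deriv2 p \<epsilon> w v u + reg_deriv2 p \<epsilon> w (\<i> * v) (- u) = reg_laplacian p \<epsilon> w v"
proof -
  define V where "V = (norm w)\<^sup>2 + \<epsilon>"
  have "0 < V"
    using assms by (simp add: V_def add_nonneg_pos)
  then have V: "V powr (p / 2 - 1) = V powr (p / 2 - 2) * V"
    using powr_add[of V "p / 2 - 2" 1] by simp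
  have sq: "(w \<bullet> v)\<^sup>2 + (w \<bullet> (\<i> * v))\<^sup>2 = (norm w)\<^sup>2 * (norm v)\<^sup>2"
    by (simp add: inner_complex_def cmod_power2) (simp add: algebra_simps power2_eq_square)
  have "reg_deriv2 p \<epsilon> w v u + reg_deriv2 p \<epsilon> w (\<i> * v) (- u) =
      p * ((p - 2) * V powr (p / 2 - 2) * ((w \<bullet> v)\<^sup>2 + (w \<bullet> (\<i> * v))\<^sup>2) + V powr (p / 2 - 1) * (2 * (norm v)\<^sup>2))"
    unfolding reg_deriv2_def V_def[symmetric] by (simp add: norm_mult algebra_simps)
  also have "\<dots> = p * V powr (p / 2 - 2) * (norm v)\<^sup>2 * ((p - 2) * (norm w)\<^sup>2 + 2 * V)"
    unfolding sq V by (simp add: algebra_simps)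
  also have "(p - 2) * (norm w)\<^sup>2 + 2 * V = p * (norm w)\<^sup>2 + 2 * \<epsilon>"
    by (simp add: V_def algebra_simps)
  finally show ?thesis
    by (simp add: reg_laplacian_def V_def)
qed

lemma normsq_plus_nonzero: "0 < \<epsilon> \<Longrightarrow> (norm w)\<^sup>2 + \<epsilon> \<noteq> (0::real)"
  by (metis add_nonneg_pos less_irrefl zero_le_power2)

lemma continuous_on_reg_powr:
  assumes "continuous_on S g" "0 < \<epsilon>"
  shows "continuous_on S (\<lambda>z. reg_powr p \<epsilon> (g z))"
  unfolding reg_powr_def by (intro continuous_intros assms ballI normsq_plus_nonzero)

lemma continuous_on_reg_deriv:
  assumes "continuous_on S g" "continuous_on S v" "0 < \<epsilon>"
  shows "continuous_on S (\<lambda>z. reg_deriv p \<epsilon> (g z) (v z))"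
  unfolding reg_deriv_def by (intro continuous_intros assms ballI normsq_plus_nonzero)

lemma continuous_on_reg_deriv2:
  assumes "continuous_on S g" "continuous_on S v" "continuous_on S u" "0 < \<epsilon>"
  shows "continuous_on S (\<lambda>z. reg_deriv2 p \<epsilon> (g z) (v z) (u z))"
  unfolding reg_deriv2_def by (intro continuous_intros assms ballI normsq_plus_nonzero)

lemma continuous_on_reg_laplacian:
  assumes "continuous_on S g" "continuous_on S v" "0 < \<epsilon>"
  shows "continuous_on S (\<lambda>z. reg_laplacian p \<epsilon> (g z) (v z))"
  unfolding reg_laplacian_def by (intro continuous_intros assms ballI normsq_plus_nonzero)

lemma continuous_on_Complex:
  fixes A :: "'a::topological_space set"
  assumes "g holomorphic_on {s. 0 < Re s}" "continuous_on A h" "continuous_on A k" "\<And>z. z \<in> A \<Longrightarrow> 0 < h z"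
  shows "continuous_on A (\<lambda>z. g (Complex (h z) (k z)))"
  using assms by (intro continuous_on_compose2[OF holomorphic_on_imp_continuous_on[OF assms(1)]])
    (auto simp: Complex_eq intro!: continuous_intros)

text \<open>The Laplacian is split into its horizontal part \<open>A\<close> and its vertical part
  \<open>B\<close>. By Fubini each is integrated first in its own variable, where a primitive is
  explicit.\<close>

lemma Green_rectangle:
  fixes f :: "complex \<Rightarrow> complex"
  assumes hol: "f holomorphic_on {s. 0 < Re s}" and \<epsilon>: "0 < \<epsilon>"
    and \<delta>: "0 < \<delta>" "\<delta> \<le> R" and T: "0 \<le> T"
  shows "integral (cbox (\<delta>, -T) (R, T)) (\<lambda>z. (fst z - \<delta>) * reg_laplacian p \<epsilon> (f (Complex (fst z) (snd z))) (deriv f (Complex (fst z) (snd z))))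
    = integral {-T..T} (\<lambda>t. (R - \<delta>) * reg_deriv p \<epsilon> (f (Complex R t)) (deriv f (Complex R t))
        - reg_powr p \<epsilon> (f (Complex R t)) + reg_powr p \<epsilon> (f (Complex \<delta> t)))
    + integral {\<delta>..R} (\<lambda>x. (x - \<delta>) * (reg_deriv p \<epsilon> (f (Complex x T)) (\<i> * deriv f (Complex x T))
        - reg_deriv p \<epsilon> (f (Complex x (-T))) (\<i> * deriv f (Complex x (-T)))))"
proof -
  let ?H = "{s. 0 < Re s}"
  define f1 where "f1 = deriv f"
  define f2 where "f2 = deriv f1"
  have opn: "open ?H" by (rule open_halfspace_Re_gt)
  have hol1: "f1 holomorphic_on ?H"
    unfolding f1_def by (intro holomorphic_deriv hol opn)
  have hol2: "f2 holomorphic_on ?H"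
    unfolding f2_def by (intro holomorphic_deriv hol1 opn)
  have d1: "(f has_field_derivative f1 s) (at s)" if "0 < Re s" for s
    unfolding f1_def using hol opn that by (auto intro!: holomorphic_derivI)
  have d2: "(f1 has_field_derivative f2 s) (at s)" if "0 < Re s" for s
    unfolding f2_def using hol1 opn that by (auto intro!: holomorphic_derivI)
  have horiz: "((\<lambda>x. g (Complex x t)) has_vector_derivative g') (at x within S)"
    if "(g has_field_derivative g') (at (Complex x t))" for g g' x t S
  proof -
    have "((\<lambda>x. Complex x t) has_vector_derivative 1) (at x within S)"
      by (auto intro!: derivative_eq_intros simp: Complex_eq)
    from field_vector_diff_chain_within[OF this has_field_derivative_at_within[OF that]]
    show ?thesis by (simp add: o_def)
  qed
  have vert: "((\<lambda>t. g (Complex x t)) has_vector_derivative \<i> * g') (at t within S)"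
    if "(g has_field_derivative g') (at (Complex x t))" for g g' x t S
  proof -
    have "((\<lambda>t. Complex x t) has_vector_derivative \<i>) (at t within S)"
      unfolding Complex_eq by (auto intro!: derivative_eq_intros)
    from field_vector_diff_chain_within[OF this has_field_derivative_at_within[OF that]]
    show ?thesis by (simp add: o_def)
  qed
  let ?Q = "cbox (\<delta>, -T) (R, T)"
  define A where "A x t = (x - \<delta>) * reg_deriv2 p \<epsilon> (f (Complex x t)) (f1 (Complex x t)) (f2 (Complex x t))" for x t
  define B where "B x t = (x - \<delta>) * reg_deriv2 p \<epsilon> (f (Complex x t)) (\<i> * f1 (Complex x t)) (- f2 (Complex x t))" for x t
  have posQ: "0 < fst z" if "z \<in> ?Q" for z
    using that \<delta> by (cases z) auto
  have contA: "continuous_on ?Q (\<lambda>(x, t). A x t)" and contB: "continuous_on ?Q (\<lambda>(x, t). B x t)"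
    unfolding A_def B_def case_prod_beta
    using posQ \<epsilon> by (intro continuous_intros continuous_on_reg_deriv2 continuous_on_Complex hol hol1 hol2; simp)+
  have "integral ?Q (\<lambda>z. (fst z - \<delta>) * reg_laplacian p \<epsilon> (f (Complex (fst z) (snd z))) (f1 (Complex (fst z) (snd z))))
      = integral ?Q (\<lambda>z. (case z of (x, t) \<Rightarrow> A x t) + (case z of (x, t) \<Rightarrow> B x t))"
    unfolding A_def B_def case_prod_beta distrib_left[symmetric] reg_laplacian_eq[OF \<epsilon>] by simp
  also have "\<dots> = integral ?Q (\<lambda>(x, t). A x t) + integral ?Q (\<lambda>(x, t). B x t)"
    by (intro integral_add integrable_continuous contA contB)
  also have "integral ?Q (\<lambda>(x, t). A x t) = integral {-T..T} (\<lambda>t. integral {\<delta>..R} (\<lambda>x. A x t))"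
    using integral_prod_continuous[OF contA] integral_swap_continuous[OF contA] by simp
  also have "\<dots> = integral {-T..T} (\<lambda>t. (R - \<delta>) * reg_deriv p \<epsilon> (f (Complex R t)) (f1 (Complex R t))
        - reg_powr p \<epsilon> (f (Complex R t)) + reg_powr p \<epsilon> (f (Complex \<delta> t)))"
  proof (rule integral_cong)
    fix t
    \<comment> \<open>The derivative of the weight produces a first-order term, which the derivative
      of the subtracted \<open>reg_powr\<close> cancels. At \<open>x = \<delta>\<close> the weight
      vanishes and only \<open>reg_powr\<close> survives.\<close>
    let ?W = "\<lambda>x. (x - \<delta>) * reg_deriv p \<epsilon> (f (Complex x t)) (f1 (Complex x t)) - reg_powr p \<epsilon> (f (Complex x t))"
    have "((\<lambda>x. A x t) has_integral (?W R - ?W \<delta>)) {\<delta>..R}"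
    proof (rule fundamental_theorem_of_calculus[OF \<delta>(2)])
      fix x assume "x \<in> {\<delta>..R}"
      then have x: "0 < Re (Complex x t)" using \<delta> by simp
      have "(?W has_real_derivative
          (1 * reg_deriv p \<epsilon> (f (Complex x t)) (f1 (Complex x t)) + reg_deriv2 p \<epsilon> (f (Complex x t)) (f1 (Complex x t)) (f2 (Complex x t)) * (x - \<delta>))
          - reg_deriv p \<epsilon> (f (Complex x t)) (f1 (Complex x t))) (at x within {\<delta>..R})"
        by (intro DERIV_diff DERIV_mult reg_powr_has_derivative reg_deriv_has_derivative horiz d1[OF x] d2[OF x] \<epsilon>)
          (auto intro!: derivative_eq_intros)
      then show "(?W has_vector_derivative A x t) (at x within {\<delta>..R})"
        by (simp add: has_real_derivative_iff_has_vector_derivative A_def mult.commute)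
    qed
    then show "integral {\<delta>..R} (\<lambda>x. A x t) = (R - \<delta>) * reg_deriv p \<epsilon> (f (Complex R t)) (f1 (Complex R t))
        - reg_powr p \<epsilon> (f (Complex R t)) + reg_powr p \<epsilon> (f (Complex \<delta> t))"
      by (simp add: integral_unique)
  qed
  also have "integral ?Q (\<lambda>(x, t). B x t) = integral {\<delta>..R} (\<lambda>x. integral {-T..T} (B x))"
    using integral_prod_continuous[OF contB] by simp
  also have "\<dots> = integral {\<delta>..R} (\<lambda>x. (x - \<delta>) * (reg_deriv p \<epsilon> (f (Complex x T)) (\<i> * f1 (Complex x T))
        - reg_deriv p \<epsilon> (f (Complex x (-T))) (\<i> * f1 (Complex x (-T)))))"
  proof (rule integral_cong)
    fix x assume x: "x \<in> {\<delta>..R}"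
    let ?W = "\<lambda>t. (x - \<delta>) * reg_deriv p \<epsilon> (f (Complex x t)) (\<i> * f1 (Complex x t))"
    have "(B x has_integral (?W T - ?W (-T))) {-T..T}"
    proof (rule fundamental_theorem_of_calculus)
      show "-T \<le> T" using T by simp
      fix t
      have x: "0 < Re (Complex x t)" using \<delta> x by simp
      have "((\<lambda>t. \<i> * f1 (Complex x t)) has_vector_derivative \<i> * (\<i> * f2 (Complex x t))) (at t within {-T..T})"
        by (intro has_vector_derivative_mult_right vert d2[OF x])
      then have "((\<lambda>t. \<i> * f1 (Complex x t)) has_vector_derivative - f2 (Complex x t)) (at t within {-T..T})"
        by (simp flip: mult.assoc)
      then have "((\<lambda>t. reg_deriv p \<epsilon> (f (Complex x t)) (\<i> * f1 (Complex x t))) has_real_derivative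
          reg_deriv2 p \<epsilon> (f (Complex x t)) (\<i> * f1 (Complex x t)) (- f2 (Complex x t))) (at t within {-T..T})"
        by (intro reg_deriv_has_derivative vert d1[OF x] \<epsilon>)
      from DERIV_cmult[OF this, of "x - \<delta>"]
      show "(?W has_vector_derivative B x t) (at t within {-T..T})"
        by (simp add: has_real_derivative_iff_has_vector_derivative B_def)
    qed
    then show "integral {-T..T} (B x) = (x - \<delta>) * (reg_deriv p \<epsilon> (f (Complex x T)) (\<i> * f1 (Complex x T))
        - reg_deriv p \<epsilon> (f (Complex x (-T))) (\<i> * f1 (Complex x (-T))))"
      by (simp add: integral_unique right_diff_distrib)
  qed
  finally show ?thesis
    by (simp add: f1_def)
qed

section \<open>Uniform estimates for the boundary terms\<close>

text \<open>The factor \<open>norm w\<close> from Cauchy-Schwarz is at most the square root of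
  \<open>(norm w)\<^sup>2 + \<epsilon>\<close>, which raises the exponent to
  \<open>(p - 1) / 2\<close>. For \<open>p \<ge> 1\<close> this is nonnegative, so the bound does
  not deteriorate as \<open>\<epsilon>\<close> tends to 0.\<close>

lemma abs_reg_deriv_le:
  assumes p: "1 \<le> p" and \<epsilon>: "0 < \<epsilon>" "\<epsilon> \<le> 1" and M: "norm w \<le> M"
  shows "\<bar>reg_deriv p \<epsilon> w v\<bar> \<le> p * (M\<^sup>2 + 1) powr ((p - 1) / 2) * norm v"
proof -
  define V where "V = (norm w)\<^sup>2 + \<epsilon>"
  have V: "0 < V"
    using \<epsilon> by (simp add: V_def add_nonneg_pos)
  have "norm w \<le> sqrt V"
    using \<epsilon> by (intro real_le_rsqrt) (simp add: V_def)
  also have "sqrt V = V powr (1/2)"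
    using V by (simp add: powr_half_sqrt)
  finally have wV: "norm w \<le> V powr (1/2)" .
  have "\<bar>w \<bullet> v\<bar> \<le> V powr (1/2) * norm v"
    using Cauchy_Schwarz_ineq2[of w v] wV by (meson mult_right_mono norm_ge_zero order_trans)
  then have "\<bar>reg_deriv p \<epsilon> w v\<bar> \<le> p * (V powr (p / 2 - 1) * (V powr (1/2) * norm v))"
    using p unfolding reg_deriv_def V_def[symmetric] abs_mult by (simp add: mult_left_mono)
  also have "\<dots> = p * V powr ((p - 1) / 2) * norm v"
    by (simp add: powr_add[symmetric] diff_divide_distrib flip: mult.assoc)
  also have "V powr ((p - 1) / 2) \<le> (M\<^sup>2 + 1) powr ((p - 1) / 2)"
    using V p \<epsilon> M unfolding V_def by (intro powr_mono2 add_mono power_mono) auto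
  finally show ?thesis
    using p by (simp add: mult_left_mono mult_right_mono)
qed

text \<open>The horizontal sides give at most the integral of
  \<open>2 * K * D / (1 + x\<^sup>2)\<close>, hence a constant. The derivative term on the right
  side is at most \<open>K * D / (1 + R\<^sup>2)\<close> over a length \<open>2 * T\<close>, and
  vanishes as \<open>R\<close> grows with \<open>T\<close> fixed.\<close>

lemma Green_rectangle_bound:
  fixes f :: "complex \<Rightarrow> complex"
  assumes hol: "f holomorphic_on {s. 0 < Re s}" and p: "1 \<le> p" and \<epsilon>: "0 < \<epsilon>" "\<epsilon> \<le> 1"
    and \<delta>: "0 < \<delta>" "\<delta> \<le> R" and T: "0 \<le> T"
    and M: "\<And>s. 0 < Re s \<Longrightarrow> norm (f s) \<le> M"
    and D: "\<And>s. 0 < Re s \<Longrightarrow> norm (deriv f s) * (Re s * (1 + (Re s)\<^sup>2)) \<le> D"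
  defines "K \<equiv> p * (M\<^sup>2 + 1) powr ((p - 1) / 2)"
  shows "\<bar>integral (cbox (\<delta>, -T) (R, T)) (\<lambda>z. (fst z - \<delta>) * reg_laplacian p \<epsilon> (f (Complex (fst z) (snd z))) (deriv f (Complex (fst z) (snd z))))
    - integral {-T..T} (\<lambda>t. reg_powr p \<epsilon> (f (Complex \<delta> t))) + integral {-T..T} (\<lambda>t. reg_powr p \<epsilon> (f (Complex R t)))\<bar>
    \<le> 2 * pi * K * D + 2 * T * K * D / (1 + R\<^sup>2)"
proof -
  have K0: "0 \<le> K" using p by (simp add: K_def)
  have D0: "0 \<le> D"
    by (rule order_trans[OF _ D[of 1]]) simp_all
  have hol1: "deriv f holomorphic_on {s. 0 < Re s}"
    by (intro holomorphic_deriv hol open_halfspace_Re_gt)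
  \<comment> \<open>The unit \<open>c\<close> covers horizontal differentiation (1) and vertical
    differentiation (\<open>\<i>\<close>) at once.\<close>
  have wt: "x * \<bar>reg_deriv p \<epsilon> (f (Complex x t)) (c * deriv f (Complex x t))\<bar> \<le> K * D / (1 + x\<^sup>2)"
    if x: "0 < x" and c: "norm c = 1" for x t c
  proof -
    have "x * \<bar>reg_deriv p \<epsilon> (f (Complex x t)) (c * deriv f (Complex x t))\<bar> \<le> x * (K * norm (c * deriv f (Complex x t)))"
      unfolding K_def using x by (intro mult_left_mono abs_reg_deriv_le p \<epsilon> M) auto
    also have "\<dots> = K * (norm (deriv f (Complex x t)) * x)"
      using c by (simp add: norm_mult)
    also have "norm (deriv f (Complex x t)) * x \<le> D / (1 + x\<^sup>2)"
      using D[of "Complex x t"] x by (simp add: pos_le_divide_eq add_pos_nonneg mult.assoc)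
    finally show ?thesis
      using K0 by (simp add: mult_left_mono)
  qed
  let ?U1 = "\<lambda>t. (R - \<delta>) * reg_deriv p \<epsilon> (f (Complex R t)) (deriv f (Complex R t))"
  let ?U2 = "\<lambda>x. (x - \<delta>) * (reg_deriv p \<epsilon> (f (Complex x T)) (\<i> * deriv f (Complex x T))
        - reg_deriv p \<epsilon> (f (Complex x (-T))) (\<i> * deriv f (Complex x (-T))))"
  have R0: "0 < R" using \<delta> by linarith
  have cont1: "continuous_on {-T..T} ?U1"
    and contR: "continuous_on {-T..T} (\<lambda>t. reg_powr p \<epsilon> (f (Complex R t)))"
    and cont\<delta>: "continuous_on {-T..T} (\<lambda>t. reg_powr p \<epsilon> (f (Complex \<delta> t)))"
    by (rule continuous_intros continuous_on_reg_powr continuous_on_reg_deriv continuous_on_Complex hol hol1 \<epsilon>(1) R0 \<delta>(1))+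
  have cont2: "continuous_on {\<delta>..R} ?U2"
    using \<delta> by (intro continuous_intros continuous_on_reg_deriv continuous_on_Complex hol hol1 \<epsilon>(1)) auto
  have "integral {-T..T} (\<lambda>t. ?U1 t - reg_powr p \<epsilon> (f (Complex R t)) + reg_powr p \<epsilon> (f (Complex \<delta> t)))
      = integral {-T..T} ?U1 - integral {-T..T} (\<lambda>t. reg_powr p \<epsilon> (f (Complex R t))) + integral {-T..T} (\<lambda>t. reg_powr p \<epsilon> (f (Complex \<delta> t)))"
    using cont1[THEN integrable_continuous_real] contR[THEN integrable_continuous_real] cont\<delta>[THEN integrable_continuous_real]
    by (simp only: integral_add integral_diff integrable_diff)
  then have eq: "integral (cbox (\<delta>, -T) (R, T)) (\<lambda>z. (fst z - \<delta>) * reg_laplacian p \<epsilon> (f (Complex (fst z) (snd z))) (deriv f (Complex (fst z) (snd z))))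
    - integral {-T..T} (\<lambda>t. reg_powr p \<epsilon> (f (Complex \<delta> t))) + integral {-T..T} (\<lambda>t. reg_powr p \<epsilon> (f (Complex R t)))
    = integral {-T..T} ?U1 + integral {\<delta>..R} ?U2"
    using Green_rectangle[OF hol \<epsilon>(1) \<delta> T, of p] by simp
  have "norm (integral {-T..T} ?U1) \<le> K * D / (1 + R\<^sup>2) * (T - (-T))"
  proof (rule integral_bound[OF _ cont1])
    fix t
    have "norm (?U1 t) \<le> R * \<bar>reg_deriv p \<epsilon> (f (Complex R t)) (1 * deriv f (Complex R t))\<bar>"
      using \<delta> by (simp add: abs_mult mult_right_mono)
    also have "\<dots> \<le> K * D / (1 + R\<^sup>2)"
      using R0 by (intro wt) auto
    finally show "norm (?U1 t) \<le> K * D / (1 + R\<^sup>2)" .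
  qed (use T in simp)
  moreover have "norm (integral {\<delta>..R} ?U2) \<le> 2 * pi * K * D"
  proof -
    have hi: "((\<lambda>x. 2 * K * D * inverse (1 + x\<^sup>2)) has_integral 2 * K * D * (arctan R - arctan \<delta>)) {\<delta>..R}"
      by (intro has_integral_mult_right fundamental_theorem_of_calculus[OF \<delta>(2)])
        (auto simp flip: has_real_derivative_iff_has_vector_derivative intro!: derivative_eq_intros)
    have "norm (integral {\<delta>..R} ?U2) \<le> integral {\<delta>..R} (\<lambda>x. 2 * K * D * inverse (1 + x\<^sup>2))"
    proof (rule integral_norm_bound_integral)
      fix x assume x: "x \<in> {\<delta>..R}"
      then have x0: "0 < x" using \<delta> by simp
      have "norm (?U2 x) \<le> x * (\<bar>reg_deriv p \<epsilon> (f (Complex x T)) (\<i> * deriv f (Complex x T))\<bar>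
          + \<bar>reg_deriv p \<epsilon> (f (Complex x (-T))) (\<i> * deriv f (Complex x (-T)))\<bar>)"
        unfolding real_norm_def abs_mult using x \<delta> by (intro mult_mono abs_triangle_ineq4) auto
      also have "\<dots> \<le> K * D / (1 + x\<^sup>2) + K * D / (1 + x\<^sup>2)"
        unfolding distrib_left using x0 by (intro add_mono wt) auto
      finally show "norm (?U2 x) \<le> 2 * K * D * inverse (1 + x\<^sup>2)"
        by (simp add: field_simps)
    qed (use hi cont2 in \<open>auto intro: integrable_continuous_real\<close>)
    also have "\<dots> = 2 * K * D * (arctan R - arctan \<delta>)"
      using hi by (rule integral_unique)
    also have "\<dots> \<le> 2 * K * D * pi"
    proof (rule mult_left_mono)
      show "arctan R - arctan \<delta> \<le> pi"
        using arctan_ubound[of R] arctan_lbound[of \<delta>] by linarith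
    qed (use K0 D0 in auto)
    finally show ?thesis by (simp add: mult_ac)
  qed
  ultimately show ?thesis
    unfolding eq using abs_triangle_ineq[of "integral {-T..T} ?U1" "integral {\<delta>..R} ?U2"] by (simp add: mult_ac)
qed

section \<open>Passage to the limit\<close>

lemma borel_measurable_half_plane:
  fixes g :: "complex \<Rightarrow> 'b::{real_normed_vector}"
  assumes "continuous_on {s. 0 < Re s} g"
  shows "(\<lambda>z::real \<times> real. if 0 < fst z then g (Complex (fst z) (snd z)) else 0) \<in> borel_measurable borel"
proof -
  let ?S = "{z::real \<times> real. 0 < fst z}"
  have "open ?S"
    by (intro open_Collect_less continuous_intros)
  moreover have "continuous_on ?S (\<lambda>z. g (Complex (fst z) (snd z)))"
    by (intro continuous_on_compose2[OF assms]) (auto simp: Complex_eq intro!: continuous_intros)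
  ultimately have "(\<lambda>z. indicator ?S z *\<^sub>R g (Complex (fst z) (snd z))) \<in> borel_measurable borel"
    by (intro borel_measurable_continuous_on_indicator) auto
  also have "(\<lambda>z. indicator ?S z *\<^sub>R g (Complex (fst z) (snd z))) = (\<lambda>z. if 0 < fst z then g (Complex (fst z) (snd z)) else 0)"
    by (auto simp: indicator_def)
  finally show ?thesis .
qed

text \<open>The zeros are countable unless \<open>f\<close> is constant. They must be discarded: at
  a zero with nonzero derivative \<open>v\<close> the smoothed Laplacian is
  \<open>2 * p * \<epsilon> powr (p / 2 - 1) * (norm v)\<^sup>2\<close>, which for
  \<open>p \<le> 2\<close> does not tend to the value given by the convention
  \<open>0 powr x = 0\<close>.\<close>

lemma AE_zero_imp_deriv_zero:
  assumes hol: "f holomorphic_on {s. 0 < Re s}"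
  shows "AE z in (lborel :: (real \<times> real) measure). 0 < fst z \<longrightarrow>
    f (Complex (fst z) (snd z)) = 0 \<longrightarrow> deriv f (Complex (fst z) (snd z)) = 0"
proof (cases "f constant_on {s. 0 < Re s}")
  case True
  then obtain c where c: "\<And>s. 0 < Re s \<Longrightarrow> f s = c"
    by (auto simp: constant_on_def)
  have "deriv f s = 0" if "0 < Re s" for s
  proof -
    have "deriv f s = deriv (\<lambda>_. c) s"
    proof (rule deriv_cong_ev)
      show "\<forall>\<^sub>F x in nhds s. f x = c"
        using eventually_nhds_in_open[OF open_halfspace_Re_gt[of 0], of s] that
        by (auto elim!: eventually_mono intro: c)
    qed simp
    then show ?thesis by simp
  qed
  then show ?thesis by simp
next
  case False
  have "connected {s. 0 < Re s}"
    by (intro convex_connected convex_halfspace_Re_gt)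
  \<comment> \<open>\<open>holomorphic_countable_zeros\<close> is applied on an F-sigma domain;
    closed half planes exhaust the open one.\<close>
  moreover have "fsigma {s. 0 < Re s}"
  proof -
    have "fsigma (\<Union>n::nat. {s. inverse (real (Suc n)) \<le> Re s})"
      by (intro fsigma.intros closed_halfspace_Re_ge)
    also have "(\<Union>n::nat. {s. inverse (real (Suc n)) \<le> Re s}) = {s. 0 < Re s}"
    proof (intro equalityI subsetI)
      fix s assume "s \<in> {s. 0 < Re s}"
      then obtain n where "inverse (real (Suc n)) < Re s"
        using reals_Archimedean[of "Re s"] by auto
      then show "s \<in> (\<Union>n::nat. {s. inverse (real (Suc n)) \<le> Re s})"
        by (intro UN_I[of n]) (auto simp del: of_nat_Suc)
    next
      fix s assume "s \<in> (\<Union>n::nat. {s. inverse (real (Suc n)) \<le> Re s})"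
      then obtain n where "inverse (real (Suc n)) \<le> Re s"
        by blast
      then show "s \<in> {s. 0 < Re s}"
        using order.strict_trans2[of 0 "inverse (real (Suc n))" "Re s"] by simp
    qed
    finally show ?thesis .
  qed
  ultimately have "countable {s \<in> {s. 0 < Re s}. f s = 0}"
    using False hol open_halfspace_Re_gt[of 0] by (intro holomorphic_countable_zeros)
  then have "countable ((\<lambda>s. (Re s, Im s)) ` {s \<in> {s. 0 < Re s}. f s = 0})"
    by simp
  from countable_imp_null_set_lborel[OF this]
  have "AE z in lborel. z \<notin> (\<lambda>s. (Re s, Im s)) ` {s \<in> {s. 0 < Re s}. f s = 0}"
    by (rule AE_not_in)
  then show ?thesis
  proof eventually_elim
    case (elim z)
    have "f (Complex (fst z) (snd z)) \<noteq> 0" if "0 < fst z"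
      using elim that by (auto simp: image_iff dest!: spec[of _ "Complex (fst z) (snd z)"])
    then show ?case by blast
  qed
qed

lemma reg_laplacian_nonneg: "0 \<le> p \<Longrightarrow> 0 < \<epsilon> \<Longrightarrow> 0 \<le> reg_laplacian p \<epsilon> w v"
  unfolding reg_laplacian_def by (intro mult_nonneg_nonneg add_nonneg_nonneg) auto

text \<open>For \<open>w \<noteq> 0\<close> the expression is continuous up to
  \<open>\<epsilon> = 0\<close>; for \<open>v = 0\<close> both sides vanish.\<close>

lemma reg_laplacian_tendsto:
  assumes "w \<noteq> 0 \<or> v = 0"
  shows "((\<lambda>\<epsilon>. reg_laplacian p \<epsilon> w v) \<longlongrightarrow> p\<^sup>2 * norm w powr (p - 2) * (norm v)\<^sup>2) (at_right 0)"
proof (cases "v = 0")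
  case True
  then show ?thesis by (simp add: reg_laplacian_def)
next
  case False
  with assms have w: "0 < norm w" by simp
  have "((\<lambda>\<epsilon>. reg_laplacian p \<epsilon> w v) \<longlongrightarrow>
      p * ((norm w)\<^sup>2 + 0) powr (p / 2 - 2) * (norm v)\<^sup>2 * (p * (norm w)\<^sup>2 + 2 * 0)) (at_right 0)"
    unfolding reg_laplacian_def using w by (intro tendsto_intros) auto
  also have "((norm w)\<^sup>2 + 0) powr (p / 2 - 2) = norm w powr (p - 4)"
    using w powr_powr[of "norm w" 2 "p / 2 - 2"] by (simp add: algebra_simps)
  also have "p * norm w powr (p - 4) * (norm v)\<^sup>2 * (p * (norm w)\<^sup>2 + 2 * 0)
      = p\<^sup>2 * (norm w powr (p - 4) * norm w powr 2) * (norm v)\<^sup>2"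
    using w by (simp add: power2_eq_square[of p] mult_ac)
  also have "norm w powr (p - 4) * norm w powr 2 = norm w powr (p - 2)"
    unfolding powr_add[symmetric] by simp
  finally show ?thesis .
qed

text \<open>A majorant free of \<open>\<epsilon>\<close> for dominated convergence. If
  \<open>p \<le> 2\<close>, the power with exponent \<open>p / 2 - 1 \<le> 0\<close> increases when
  \<open>\<epsilon>\<close> is dropped; if \<open>p > 2\<close>, it is bounded and the density for
  exponent 2 remains. The constant is the sum of those of the two cases.\<close>

lemma reg_laplacian_le:
  assumes p: "1 \<le> p" and \<epsilon>: "0 < \<epsilon>" "\<epsilon> \<le> 1" and w: "w \<noteq> 0" "norm w \<le> M"
  shows "reg_laplacian p \<epsilon> w v \<le> (2 * p + p\<^sup>2 * (M\<^sup>2 + 1) powr (p / 2 - 1)) * (norm w powr (min p 2 - 2) * (norm v)\<^sup>2)"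
proof -
  define V where "V = (norm w)\<^sup>2 + \<epsilon>"
  have V: "0 < V"
    using \<epsilon> by (simp add: V_def add_nonneg_pos)
  have Vp: "V powr (p / 2 - 1) = V powr (p / 2 - 2) * V"
    using V powr_add[of V "p / 2 - 2" 1] by simp
  have lap: "reg_laplacian p \<epsilon> w v \<le> c * V powr (p / 2 - 1) * (norm v)\<^sup>2"
    if "p * (p * (norm w)\<^sup>2 + 2 * \<epsilon>) \<le> c * V" for c
  proof -
    have "reg_laplacian p \<epsilon> w v = (V powr (p / 2 - 2) * (norm v)\<^sup>2) * (p * (p * (norm w)\<^sup>2 + 2 * \<epsilon>))"
      by (simp add: reg_laplacian_def V_def mult_ac)
    also have "\<dots> \<le> (V powr (p / 2 - 2) * (norm v)\<^sup>2) * (c * V)"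
      using that by (intro mult_left_mono) auto
    finally show ?thesis
      by (simp add: Vp mult_ac)
  qed
  have wp: "0 < norm w" using w by simp
  define c where "c = (M\<^sup>2 + 1) powr (p / 2 - 1)"
  have c0: "0 \<le> c" by (simp add: c_def)
  show ?thesis
  proof (cases "p \<le> 2")
    case True
    have "p * (p * (norm w)\<^sup>2 + 2 * \<epsilon>) \<le> p * (2 * (norm w)\<^sup>2 + 2 * \<epsilon>)"
      using p True by (intro mult_left_mono add_right_mono mult_right_mono) auto
    then have "reg_laplacian p \<epsilon> w v \<le> (2 * p) * V powr (p / 2 - 1) * (norm v)\<^sup>2"
      by (intro lap) (simp add: V_def algebra_simps)
    also have "V powr (p / 2 - 1) \<le> ((norm w)\<^sup>2) powr (p / 2 - 1)"
      using wp \<epsilon> True by (intro powr_mono2') (auto simp: V_def)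
    also have "((norm w)\<^sup>2) powr (p / 2 - 1) = norm w powr (p - 2)"
      using wp powr_powr[of "norm w" 2 "p / 2 - 1"] by (simp add: algebra_simps)
    finally have "reg_laplacian p \<epsilon> w v \<le> (2 * p) * (norm w powr (p - 2) * (norm v)\<^sup>2)"
      using p by (simp add: mult_left_mono mult_right_mono mult.assoc)
    also have "\<dots> \<le> (2 * p + p\<^sup>2 * c) * (norm w powr (p - 2) * (norm v)\<^sup>2)"
      using c0 by (intro mult_right_mono) auto
    finally show ?thesis
      using True by (simp add: c_def min_def)
  next
    case False
    have "p * (p * (norm w)\<^sup>2 + 2 * \<epsilon>) \<le> p * (p * (norm w)\<^sup>2 + p * \<epsilon>)"
      using p False \<epsilon> by (intro mult_left_mono add_left_mono mult_right_mono) auto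
    then have "reg_laplacian p \<epsilon> w v \<le> p\<^sup>2 * V powr (p / 2 - 1) * (norm v)\<^sup>2"
      by (intro lap) (simp add: V_def algebra_simps power2_eq_square)
    also have "V powr (p / 2 - 1) \<le> c"
      unfolding c_def V_def using w \<epsilon> False by (intro powr_mono2 add_mono power_mono) auto
    finally have "reg_laplacian p \<epsilon> w v \<le> p\<^sup>2 * c * (norm v)\<^sup>2"
      by (simp add: mult_left_mono mult_right_mono)
    also have "\<dots> \<le> (2 * p + p\<^sup>2 * c) * (norm v)\<^sup>2"
      using p by (intro mult_right_mono) auto
    finally show ?thesis
      using False wp by (simp add: c_def min_def)
  qed
qed

text \<open>Tonelli's theorem turns the iterated integral into one over a half strip, where the
  convergence theorems in the plane apply.\<close>

lemma LP_area_eq_nn_integral: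
  assumes hol: "f holomorphic_on {s. 0 < Re s}"
  shows "LP_area f p T = (\<integral>\<^sup>+ z\<in>{0<..} \<times> {-T..T}. ennreal (norm (f (Complex (fst z) (snd z))) powr (p - 2)
      * (norm (deriv f (Complex (fst z) (snd z))))\<^sup>2 * fst z) \<partial>lborel)" (is "_ = ?R")
    and "(\<lambda>z. ennreal (norm (f (Complex (fst z) (snd z))) powr (p - 2) * (norm (deriv f (Complex (fst z) (snd z))))\<^sup>2 * fst z)
      * indicator ({0<..} \<times> {-T..T}) z) \<in> borel_measurable lborel" (is "?h \<in> _")
proof -
  \<comment> \<open>Nothing is known about \<open>f\<close> off the half plane; replacing it by 0
    there gives Borel functions and leaves the integrand unchanged because of the indicator.\<close>
  define F where "F = (\<lambda>z::real \<times> real. if 0 < fst z then f (Complex (fst z) (snd z)) else 0)"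
  define G where "G = (\<lambda>z::real \<times> real. if 0 < fst z then deriv f (Complex (fst z) (snd z)) else 0)"
  have [measurable]: "F \<in> borel_measurable borel" "G \<in> borel_measurable borel"
    unfolding F_def G_def
    by (intro borel_measurable_half_plane holomorphic_on_imp_continuous_on hol holomorphic_deriv open_halfspace_Re_gt)+
  have h: "?h = (\<lambda>z. ennreal (norm (F z) powr (p - 2) * (norm (G z))\<^sup>2 * fst z) * indicator ({0<..} \<times> {-T..T}) z)"
    by (auto simp: F_def G_def indicator_def fun_eq_iff)
  have S: "{0<..} \<times> {-T..T} \<in> sets (borel :: (real \<times> real) measure)"
    by (intro borel_Times) auto
  have [measurable]: "fst \<in> borel_measurable (borel :: (real \<times> real) measure)"
    by (intro borel_measurable_continuous_onI continuous_intros)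
  have [measurable]: "indicator ({0<..} \<times> {-T..T}) \<in> borel_measurable (borel :: (real \<times> real) measure)"
    using S by (rule borel_measurable_indicator)
  show m: "?h \<in> borel_measurable lborel"
    unfolding h by measurable
  have "?R = (\<integral>\<^sup>+ z. ?h z \<partial>(lborel \<Otimes>\<^sub>M lborel))"
    by (simp add: lborel_prod)
  also have "\<dots> = (\<integral>\<^sup>+ x. \<integral>\<^sup>+ t. ?h (x, t) \<partial>lborel \<partial>lborel)"
    using m by (intro lborel.nn_integral_fst[symmetric]) (simp add: lborel_prod)
  also have "\<dots> = LP_area f p T"
    unfolding LP_area_def
  proof (intro nn_integral_cong)
    fix x :: real
    show "(\<integral>\<^sup>+ t. ?h (x, t) \<partial>lborel) = (\<integral>\<^sup>+ t\<in>{-T..T}. ennreal (norm (f (Complex x t)) powr (p - 2) * (norm (deriv f (Complex x t)))\<^sup>2 * x)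
        \<partial>lborel) * indicator {0<..} x"
      by (cases "0 < x") (auto simp: indicator_times intro!: nn_integral_cong)
  qed
  finally show "LP_area f p T = ?R" ..
qed

lemma divide_one_plus_square_tendsto_0: "((\<lambda>x::real. C / (1 + x\<^sup>2)) \<longlongrightarrow> (0::real)) at_top"
  by (intro tendsto_divide_0[OF tendsto_const] filterlim_at_top_imp_at_infinity
      filterlim_tendsto_add_at_top[OF tendsto_const] filterlim_pow_at_top filterlim_ident) simp

section \<open>Limits of the smoothed identity for fixed \<open>T\<close>\<close>

locale decaying_half_plane =
  fixes f :: "complex \<Rightarrow> complex" and M D :: real
  assumes hol: "f holomorphic_on {s. 0 < Re s}"
    and M: "\<And>s. 0 < Re s \<Longrightarrow> norm (f s) \<le> M"
    and D: "\<And>s. 0 < Re s \<Longrightarrow> norm (deriv f s) * (Re s * (1 + (Re s)\<^sup>2)) \<le> D"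
begin

definition K :: "real \<Rightarrow> real" where
  "K p = p * (M\<^sup>2 + 1) powr ((p - 1) / 2)"

definition \<delta> :: "nat \<Rightarrow> real" where "\<delta> n = inverse (real (Suc n))"

text \<open>The same null sequence serves as \<open>\<epsilon>\<close> and as the left side of the rectangle; the right side is \<open>Suc n\<close>.\<close>
definition area_integrand :: "real \<Rightarrow> nat \<Rightarrow> real \<times> real \<Rightarrow> real" where
  "area_integrand p n z = (fst z - \<delta> n) * reg_laplacian p (\<delta> n) (f (Complex (fst z) (snd z))) (deriv f (Complex (fst z) (snd z)))"

definition area :: "real \<Rightarrow> real \<Rightarrow> nat \<Rightarrow> real" where
  "area p T n = integral (cbox (\<delta> n, -T) (real (Suc n), T)) (area_integrand p n)"

text \<open>Cut off to its rectangle and viewed on the whole plane, so that Fatou's lemma and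
  dominated convergence can be used although the domain varies with \<open>n\<close>.\<close>

definition area_fun :: "real \<Rightarrow> real \<Rightarrow> nat \<Rightarrow> real \<times> real \<Rightarrow> ennreal" where
  "area_fun p T n z = ennreal (area_integrand p n z) * indicator (cbox (\<delta> n, -T) (real (Suc n), T)) z"

definition area_limit :: "real \<Rightarrow> real \<Rightarrow> real \<times> real \<Rightarrow> ennreal" where
  "area_limit p T z = ennreal (norm (f (Complex (fst z) (snd z))) powr (p - 2)
      * (norm (deriv f (Complex (fst z) (snd z))))\<^sup>2 * fst z) * indicator ({0<..} \<times> {-T..T}) z"

lemma \<delta>: "0 < \<delta> n" "\<delta> n \<le> 1" "\<delta> n \<le> real (Suc n)"
proof -
  show "0 < \<delta> n" by (simp add: \<delta>_def)
  show 1: "\<delta> n \<le> 1" by (simp add: \<delta>_def inverse_le_1_iff)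
  show "\<delta> n \<le> real (Suc n)" by (rule order_trans[OF 1]) simp
qed

lemma \<delta>_at_right: "filterlim \<delta> (at_right 0) sequentially"
  unfolding filterlim_at using LIMSEQ_inverse_real_of_nat \<delta> by (auto simp: \<delta>_def[abs_def])

lemma hol': "deriv f holomorphic_on {s. 0 < Re s}"
  by (intro holomorphic_deriv hol open_halfspace_Re_gt)

lemma continuous_on_area_integrand:
  "continuous_on (cbox (\<delta> n, -T) (real (Suc n), T)) (area_integrand p n)"
proof -
  have pos: "0 < fst z" if "z \<in> cbox (\<delta> n, -T) (real (Suc n), T)" for z
    using that \<delta>(1)[of n] by (cases z) auto
  show ?thesis
    unfolding area_integrand_def
    by (intro continuous_intros continuous_on_reg_laplacian continuous_on_Complex hol hol' pos \<delta>(1))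
qed

lemma area_integrand_nonneg:
  assumes "1 \<le> p" "z \<in> cbox (\<delta> n, -T) (real (Suc n), T)"
  shows "0 \<le> area_integrand p n z"
  using assms \<delta>(1)[of n] unfolding area_integrand_def
  by (cases z) (auto intro!: mult_nonneg_nonneg reg_laplacian_nonneg)

lemma area_fun_measurable: "area_fun p T n \<in> borel_measurable lborel"
proof -
  have "(\<lambda>z. indicator (cbox (\<delta> n, -T) (real (Suc n), T)) z *\<^sub>R area_integrand p n z) \<in> borel_measurable borel"
    by (rule borel_measurable_continuous_on_indicator[OF _ continuous_on_area_integrand]) simp
  then have "(\<lambda>z. ennreal (indicator (cbox (\<delta> n, -T) (real (Suc n), T)) z *\<^sub>R area_integrand p n z)) \<in> borel_measurable lborel"
    by simp
  also have "(\<lambda>z. ennreal (indicator (cbox (\<delta> n, -T) (real (Suc n), T)) z *\<^sub>R area_integrand p n z)) = area_fun p T n"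
    by (auto simp: area_fun_def indicator_def fun_eq_iff)
  finally show ?thesis .
qed

lemma area_nonneg: "1 \<le> p \<Longrightarrow> 0 \<le> area p T n"
  unfolding area_def
  by (intro integral_nonneg integrable_continuous continuous_on_area_integrand area_integrand_nonneg)

lemma nn_integral_area_fun:
  assumes "1 \<le> p"
  shows "(\<integral>\<^sup>+ z. area_fun p T n z \<partial>lborel) = ennreal (area p T n)"
  unfolding area_fun_def area_def
  by (intro nn_integral_has_integral_lebesgue' area_integrand_nonneg[OF assms] integrable_integral
      integrable_continuous continuous_on_area_integrand)

lemma area_limit_measurable: "area_limit p T \<in> borel_measurable lborel"
  unfolding area_limit_def[abs_def] by (rule LP_area_eq_nn_integral(2)[OF hol])

lemma nn_integral_area_limit: "(\<integral>\<^sup>+ z. area_limit p T z \<partial>lborel) = LP_area f p T"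
  unfolding area_limit_def LP_area_eq_nn_integral(1)[OF hol] ..

text \<open>Each point of the half strip eventually lies in the rectangles, so the cutoff does not
  affect the limit; points outside lie in none of them.\<close>

lemma area_fun_tendsto:
  "AE z in lborel. (\<lambda>n. area_fun p T n z) \<longlonglongrightarrow> ennreal (p\<^sup>2) * area_limit p T z"
  using AE_zero_imp_deriv_zero[OF hol]
proof eventually_elim
  case (elim z)
  obtain x t where z: "z = (x, t)" by (cases z)
  show ?case
  proof (cases "0 < x \<and> t \<in> {-T..T}")
    case False
    then have "z \<notin> cbox (\<delta> n, -T) (real (Suc n), T)" for n
      using \<delta>(1)[of n] by (auto simp: z)
    then show ?thesis
      using False by (auto simp: area_fun_def area_limit_def z)
  next
    case True
    have "(\<lambda>n. reg_laplacian p (\<delta> n) (f (Complex x t)) (deriv f (Complex x t))) \<longlonglongrightarrow>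
        p\<^sup>2 * norm (f (Complex x t)) powr (p - 2) * (norm (deriv f (Complex x t)))\<^sup>2"
      using elim True by (intro filterlim_compose[OF reg_laplacian_tendsto \<delta>_at_right]) (auto simp: z)
    moreover have \<delta>0: "\<delta> \<longlonglongrightarrow> 0"
      using \<delta>_at_right by (simp add: filterlim_at)
    ultimately have "(\<lambda>n. ennreal (area_integrand p n z)) \<longlonglongrightarrow>
        ennreal ((x - 0) * (p\<^sup>2 * norm (f (Complex x t)) powr (p - 2) * (norm (deriv f (Complex x t)))\<^sup>2))"
      unfolding area_integrand_def z fst_conv snd_conv by (intro tendsto_intros)
    also have "ennreal ((x - 0) * (p\<^sup>2 * norm (f (Complex x t)) powr (p - 2) * (norm (deriv f (Complex x t)))\<^sup>2))
        = ennreal (p\<^sup>2) * area_limit p T z"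
      using True by (simp add: area_limit_def z ennreal_mult[symmetric] mult_ac)
    finally have lim: "(\<lambda>n. ennreal (area_integrand p n z)) \<longlonglongrightarrow> ennreal (p\<^sup>2) * area_limit p T z" .
    have "\<forall>\<^sub>F n in sequentially. \<delta> n < x"
      using order_tendstoD(2)[OF \<delta>0] True by auto
    moreover have "\<forall>\<^sub>F n in sequentially. x \<le> real (Suc n)"
      using eventually_ge_at_top[of "nat \<lceil>x\<rceil>"] by eventually_elim linarith
    ultimately have "\<forall>\<^sub>F n in sequentially. ennreal (area_integrand p n z) = area_fun p T n z"
      by eventually_elim (use True in \<open>auto simp: area_fun_def z\<close>)
    then show ?thesis
      using lim by (rule Lim_transform_eventually[rotated])
  qed
qed

lemma area_bound:
  assumes "1 \<le> p" "0 \<le> T"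
  shows "\<bar>area p T n - integral {-T..T} (\<lambda>t. reg_powr p (\<delta> n) (f (Complex (\<delta> n) t)))
    + integral {-T..T} (\<lambda>t. reg_powr p (\<delta> n) (f (Complex (real (Suc n)) t)))\<bar>
    \<le> 2 * pi * K p * D + 2 * T * K p * D / (1 + (real (Suc n))\<^sup>2)"
  using Green_rectangle_bound[OF hol assms(1) \<delta>(1,2)[of n] \<delta>(1,3)[of n] assms(2) M D]
  unfolding area_def area_integrand_def[abs_def] K_def by simp

lemma reg_powr_bounds:
  assumes "1 \<le> p" "0 < Re s"
  shows "0 \<le> reg_powr p (\<delta> n) (f s)" "reg_powr p (\<delta> n) (f s) \<le> (M\<^sup>2 + 1) powr (p / 2)"
  using assms \<delta>[of n] M[OF assms(2)] unfolding reg_powr_def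
  by (auto intro!: powr_mono2 add_mono power_mono)

lemma continuous_on_reg_powr_vertical:
  assumes "0 < x"
  shows "continuous_on A (\<lambda>t. reg_powr p (\<delta> n) (f (Complex x t)))"
  using assms by (intro continuous_on_reg_powr continuous_on_Complex hol \<delta>(1) continuous_intros)

text \<open>By \<open>area_bound\<close> the smoothed areas are bounded in \<open>n\<close>, and
  Fatou's lemma passes the bound to the limit.\<close>

lemma LP_area_finite:
  assumes p: "1 \<le> p" and T: "0 \<le> T"
  shows "LP_area f p T < \<infinity>"
proof -
  \<comment> \<open>The horizontal sides, the right-side derivative term with its denominator
    replaced by 1, and the trivial bound for the integral over the left side. The integral over the
    right side is nonnegative and is dropped.\<close>
  define C where "C = 2 * pi * K p * D + 2 * T * K p * D + (M\<^sup>2 + 1) powr (p / 2) * (T - (-T))"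
  have D0: "0 \<le> D"
    by (rule order_trans[OF _ D[of 1]]) simp_all
  have KD: "0 \<le> K p * D"
    using p D0 by (simp add: K_def)
  have le: "area p T n \<le> C" for n
  proof -
    have "norm (integral {-T..T} (\<lambda>t. reg_powr p (\<delta> n) (f (Complex (\<delta> n) t)))) \<le> (M\<^sup>2 + 1) powr (p / 2) * (T - (-T))"
      using T reg_powr_bounds[OF p] \<delta>(1)[of n]
      by (intro integral_bound continuous_on_reg_powr_vertical) auto
    moreover have "0 \<le> integral {-T..T} (\<lambda>t. reg_powr p (\<delta> n) (f (Complex (real (Suc n)) t)))"
      using reg_powr_bounds[OF p]
      by (intro integral_nonneg integrable_continuous_real continuous_on_reg_powr_vertical) auto
    moreover have "2 * T * K p * D / (1 + (real (Suc n))\<^sup>2) \<le> 2 * T * K p * D / 1"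
      using T KD by (intro divide_left_mono) (auto simp: mult.assoc add_pos_nonneg)
    ultimately show ?thesis
      using area_bound[OF p T, of n] unfolding C_def by (simp del: of_nat_Suc)
  qed
  have "ennreal (p\<^sup>2) * LP_area f p T = (\<integral>\<^sup>+ z. ennreal (p\<^sup>2) * area_limit p T z \<partial>lborel)"
    by (subst nn_integral_cmult[OF area_limit_measurable]) (simp add: nn_integral_area_limit)
  also have "\<dots> = (\<integral>\<^sup>+ z. liminf (\<lambda>n. area_fun p T n z) \<partial>lborel)"
  proof (rule nn_integral_cong_AE)
    show "AE z in lborel. ennreal (p\<^sup>2) * area_limit p T z = liminf (\<lambda>n. area_fun p T n z)"
      using area_fun_tendsto[of p T] by eventually_elim (auto dest!: lim_imp_Liminf[rotated])
  qed
  also have "\<dots> \<le> liminf (\<lambda>n. \<integral>\<^sup>+ z. area_fun p T n z \<partial>lborel)"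
    by (intro nn_integral_liminf area_fun_measurable)
  also have "\<dots> \<le> ennreal C"
    unfolding nn_integral_area_fun[OF p]
    by (intro order_trans[OF Liminf_le_Limsup Limsup_bounded]) (auto intro!: always_eventually ennreal_leI le)
  finally have "ennreal (p\<^sup>2) * LP_area f p T < \<infinity>"
    by (simp add: order_le_less_trans)
  then show ?thesis
    using p by (auto simp: ennreal_mult_less_top)
qed

text \<open>Dominated convergence: \<open>area_fun_tendsto\<close> gives the pointwise limit,
  \<open>reg_laplacian_le\<close> the majorant, and \<open>LP_area_finite\<close> its
  integrability.\<close>

lemma area_tendsto:
  assumes p: "1 \<le> p" and T: "0 \<le> T"
  shows "(\<lambda>n. area p T n) \<longlonglongrightarrow> p\<^sup>2 * enn2real (LP_area f p T)"
proof -
  define c where "c = 2 * p + p\<^sup>2 * (M\<^sup>2 + 1) powr (p / 2 - 1)"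
  have c0: "0 \<le> c" using p by (simp add: c_def)
  \<comment> \<open>For \<open>p > 2\<close> the dominating function comes from the finiteness of the area integral for exponent 2.\<close>
  have q: "1 \<le> min p 2" using p by simp
  have "(\<lambda>n. \<integral>\<^sup>+ z. area_fun p T n z \<partial>lborel) \<longlonglongrightarrow> (\<integral>\<^sup>+ z. ennreal (p\<^sup>2) * area_limit p T z \<partial>lborel)"
  proof (rule nn_integral_dominated_convergence[where w = "\<lambda>z. ennreal c * area_limit (min p 2) T z"])
    show "area_fun p T n \<in> borel_measurable lborel" for n
      by (rule area_fun_measurable)
    show "(\<lambda>z. ennreal (p\<^sup>2) * area_limit p T z) \<in> borel_measurable lborel"
      "(\<lambda>z. ennreal c * area_limit (min p 2) T z) \<in> borel_measurable lborel"
      using area_limit_measurable by measurable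
    show "(\<integral>\<^sup>+ z. ennreal c * area_limit (min p 2) T z \<partial>lborel) < \<infinity>"
      using LP_area_finite[OF q T]
      by (subst nn_integral_cmult[OF area_limit_measurable]) (simp add: nn_integral_area_limit ennreal_mult_less_top)
    show "AE z in lborel. area_fun p T n z \<le> ennreal c * area_limit (min p 2) T z" for n
      using AE_zero_imp_deriv_zero[OF hol]
    proof eventually_elim
      case (elim z)
      show ?case
      proof (cases "z \<in> cbox (\<delta> n, -T) (real (Suc n), T)")
        case True
        define w v where "w = f (Complex (fst z) (snd z))" and "v = deriv f (Complex (fst z) (snd z))"
        have z: "\<delta> n \<le> fst z" "snd z \<in> {-T..T}" "0 < fst z"
          using True \<delta>(1)[of n] by (cases z; auto)+
        have "reg_laplacian p (\<delta> n) w v \<le> c * (norm w powr (min p 2 - 2) * (norm v)\<^sup>2)"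
        proof (cases "w = 0")
          \<comment> \<open>\<open>reg_laplacian_le\<close> excludes zeros of \<open>f\<close>;
            almost everywhere the derivative vanishes there too, and so does the smoothed
            Laplacian.\<close>
          case True
          then have "v = 0" using elim z by (simp add: w_def v_def)
          then show ?thesis by (simp add: reg_laplacian_def)
        next
          case False
          then show ?thesis
            unfolding c_def using z by (intro reg_laplacian_le p \<delta>) (auto simp: w_def intro!: M)
        qed
        then have "(fst z - \<delta> n) * reg_laplacian p (\<delta> n) w v \<le> fst z * (c * (norm w powr (min p 2 - 2) * (norm v)\<^sup>2))"
          using z p \<delta>[of n] by (intro mult_mono reg_laplacian_nonneg) auto
        then have "ennreal (area_integrand p n z) \<le> ennreal (c * (norm w powr (min p 2 - 2) * (norm v)\<^sup>2 * fst z))"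
          unfolding area_integrand_def w_def v_def by (intro ennreal_leI) (simp add: mult_ac)
        also have "\<dots> = ennreal c * area_limit (min p 2) T z"
          using c0 z by (subst ennreal_mult) (auto simp: area_limit_def w_def v_def indicator_def mem_Times_iff)
        finally show ?thesis
          using True by (simp add: area_fun_def)
      qed (simp add: area_fun_def)
    qed
    show "AE z in lborel. (\<lambda>n. area_fun p T n z) \<longlonglongrightarrow> ennreal (p\<^sup>2) * area_limit p T z"
      by (rule area_fun_tendsto)
  qed
  also have "(\<integral>\<^sup>+ z. ennreal (p\<^sup>2) * area_limit p T z \<partial>lborel) = ennreal (p\<^sup>2) * LP_area f p T"
    by (subst nn_integral_cmult[OF area_limit_measurable]) (simp add: nn_integral_area_limit)
  also have "\<dots> = ennreal (p\<^sup>2 * enn2real (LP_area f p T))"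
    using LP_area_finite[OF p T] by (simp add: ennreal_mult)
  finally have "(\<lambda>n. ennreal (area p T n)) \<longlonglongrightarrow> ennreal (p\<^sup>2 * enn2real (LP_area f p T))"
    unfolding nn_integral_area_fun[OF p] .
  then show ?thesis
    by (subst (asm) tendsto_ennreal_iff) (auto intro!: always_eventually area_nonneg[OF p])
qed

text \<open>Bounded convergence. The abscissae \<open>x n\<close> are left free so that both
  vertical sides are covered: \<open>\<delta> n\<close> tending to the boundary and
  \<open>Suc n\<close> tending to infinity.\<close>

lemma reg_powr_integral_tendsto:
  assumes p: "1 \<le> p" and T: "0 \<le> T" and x: "\<And>n. 0 < x n"
    and g: "g \<in> borel_measurable lborel"
    and lim: "AE t in lborel. (\<lambda>n. f (Complex (x n) t)) \<longlonglongrightarrow> g t"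
  shows "(\<lambda>n. integral {-T..T} (\<lambda>t. reg_powr p (\<delta> n) (f (Complex (x n) t)))) \<longlonglongrightarrow> (LBINT t:{-T..T}. norm (g t) powr p)"
proof -
  have \<delta>0: "\<delta> \<longlonglongrightarrow> 0"
    using \<delta>_at_right by (simp add: filterlim_at)
  have int: "set_integrable lborel {-T..T} (\<lambda>t. reg_powr p (\<delta> n) (f (Complex (x n) t)))" for n
    by (intro borel_integrable_atLeastAtMost' continuous_on_reg_powr_vertical x)
  have "(\<lambda>n. LBINT t:{-T..T}. reg_powr p (\<delta> n) (f (Complex (x n) t))) \<longlonglongrightarrow> (LBINT t:{-T..T}. norm (g t) powr p)"
    unfolding set_lebesgue_integral_def
  proof (rule integral_dominated_convergence[where w = "\<lambda>t. indicator {-T..T} t *\<^sub>R (M\<^sup>2 + 1) powr (p / 2)"])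
    show "(\<lambda>t. indicator {-T..T} t *\<^sub>R norm (g t) powr p) \<in> borel_measurable lborel"
      using g by measurable
    show "(\<lambda>t. indicator {-T..T} t *\<^sub>R reg_powr p (\<delta> n) (f (Complex (x n) t))) \<in> borel_measurable lborel" for n
      using int[of n] unfolding set_integrable_def by (rule borel_measurable_integrable)
    show "integrable lborel (\<lambda>t. indicator {-T..T} t *\<^sub>R (M\<^sup>2 + 1) powr (p / 2))"
      using borel_integrable_atLeastAtMost'[of "-T" T "\<lambda>_. (M\<^sup>2 + 1) powr (p / 2)"] unfolding set_integrable_def by simp
    show "AE t in lborel. norm (indicator {-T..T} t *\<^sub>R reg_powr p (\<delta> n) (f (Complex (x n) t))) \<le> indicator {-T..T} t *\<^sub>R (M\<^sup>2 + 1) powr (p / 2)" for n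
      using reg_powr_bounds[OF p] x[of n] by (intro AE_I2) (auto simp: indicator_def)
    show "AE t in lborel. (\<lambda>n. indicator {-T..T} t *\<^sub>R reg_powr p (\<delta> n) (f (Complex (x n) t))) \<longlonglongrightarrow> indicator {-T..T} t *\<^sub>R norm (g t) powr p"
      using lim
    proof eventually_elim
      case (elim t)
      have "(\<lambda>n. reg_powr p (\<delta> n) (f (Complex (x n) t))) \<longlonglongrightarrow> ((norm (g t))\<^sup>2 + 0) powr (p / 2)"
        unfolding reg_powr_def
      \<comment> \<open>The limiting base may be 0 where \<open>g\<close> vanishes; the positive
        exponent \<open>p / 2\<close> keeps the power continuous there.\<close>
      proof (rule tendsto_powr2)
        show "(\<lambda>n. (norm (f (Complex (x n) t)))\<^sup>2 + \<delta> n) \<longlonglongrightarrow> (norm (g t))\<^sup>2 + 0"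
          by (intro tendsto_intros elim \<delta>0)
        show "\<forall>\<^sub>F n in sequentially. 0 \<le> (norm (f (Complex (x n) t)))\<^sup>2 + \<delta> n"
          using \<delta>(1) by (intro always_eventually allI add_nonneg_nonneg) (auto intro: less_imp_le)
      qed (use p in auto)
      moreover have "((norm (g t))\<^sup>2 + 0) powr (p / 2) = norm (g t) powr p"
        using powr_powr[of "norm (g t)" 2 "p / 2"] by simp
      ultimately show ?case
        by (intro tendsto_intros) simp
    qed
  qed
  then show ?thesis
    by (simp add: set_borel_integral_eq_integral(2)[OF int])
qed

text \<open>The limit of \<open>area_bound\<close> in \<open>n\<close> at fixed \<open>T\<close>:
  the only error term containing \<open>T\<close> has the denominator
  \<open>1 + (Suc n)\<^sup>2\<close> and disappears.\<close>

lemma Littlewood_Paley_bound: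
  assumes p: "1 \<le> p" and T: "0 \<le> T" and g: "g \<in> borel_measurable lborel"
    and lim: "AE t in lborel. ((\<lambda>x. f (Complex x t)) \<longlongrightarrow> g t) (at_right 0)"
    and lim_inf: "\<And>t. ((\<lambda>x. f (Complex x t)) \<longlongrightarrow> c) at_top"
  shows "\<bar>(LBINT t:{-T..T}. norm (g t) powr p) - 2 * T * norm c powr p - p\<^sup>2 * enn2real (LP_area f p T)\<bar> \<le> 2 * pi * K p * D"
proof -
  have Suc_at_top: "filterlim (\<lambda>n. real (Suc n)) at_top sequentially"
    by (rule filterlim_compose[OF filterlim_real_sequentially filterlim_Suc])
  have X: "(\<lambda>n. integral {-T..T} (\<lambda>t. reg_powr p (\<delta> n) (f (Complex (\<delta> n) t)))) \<longlonglongrightarrow> (LBINT t:{-T..T}. norm (g t) powr p)"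
    using lim by (intro reg_powr_integral_tendsto p T \<delta>(1) g) (auto elim!: eventually_mono intro: filterlim_compose \<delta>_at_right)
  have "(\<lambda>n. integral {-T..T} (\<lambda>t. reg_powr p (\<delta> n) (f (Complex (real (Suc n)) t)))) \<longlonglongrightarrow> (LBINT t:{-T..T}. norm c powr p)"
    by (intro reg_powr_integral_tendsto p T AE_I2 filterlim_compose[OF lim_inf] Suc_at_top) auto
  moreover have "(LBINT t:{-T..T}. norm c powr p) = 2 * T * norm c powr p"
    using T by (simp add: set_lebesgue_integral_def)
  ultimately have Y: "(\<lambda>n. integral {-T..T} (\<lambda>t. reg_powr p (\<delta> n) (f (Complex (real (Suc n)) t)))) \<longlonglongrightarrow> 2 * T * norm c powr p"
    by simp
  have Z: "(\<lambda>n. 2 * pi * K p * D + 2 * T * K p * D / (1 + (real (Suc n))\<^sup>2)) \<longlonglongrightarrow> 2 * pi * K p * D + 0"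
    by (intro tendsto_add tendsto_const filterlim_compose[OF divide_one_plus_square_tendsto_0] Suc_at_top)
  have "\<bar>p\<^sup>2 * enn2real (LP_area f p T) - (LBINT t:{-T..T}. norm (g t) powr p) + 2 * T * norm c powr p\<bar> \<le> 2 * pi * K p * D + 0"
    by (rule LIMSEQ_le[OF tendsto_rabs[OF tendsto_add[OF tendsto_diff[OF area_tendsto[OF p T] X] Y]] Z])
      (use area_bound[OF p T] in blast)
  then show ?thesis
    by (simp add: abs_minus_commute algebra_simps)
qed

end

text \<open>\<open>Littlewood_Paley_bound\<close> controls the difference before division by a
  constant free of \<open>T\<close>; dividing by \<open>2 * T\<close> gives the limit. Finiteness of
  \<open>LP_area\<close> is asserted because \<open>enn2real\<close> maps infinity to 0.\<close>

theorem theorem1p4: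
  fixes p :: real and f :: "complex \<Rightarrow> complex" and a :: "nat \<Rightarrow> complex"
  assumes "1 \<le> p"
    and "Hinf_dirichlet f a"
  shows "\<exists>g :: real \<Rightarrow> complex. g \<in> borel_measurable lborel \<and>
     (AE \<tau> in lborel. ((\<lambda>\<sigma>. f (Complex \<sigma> \<tau>)) \<longlongrightarrow> g \<tau>) (at_right 0)) \<and>
     (\<forall>\<^sub>F T in at_top. LP_area f p T < \<infinity>) \<and>
     ((\<lambda>T. \<bar>(1 / (2 * T)) * (LBINT \<tau>=-T..T. norm (g \<tau>) powr p)
            - norm (a 1) powr p
            - p\<^sup>2 / (2 * T) * enn2real (LP_area f p T)\<bar>) \<longlongrightarrow> 0) at_top"
proof -
  have hol: "f holomorphic_on {s. 0 < Re s}" and bdd: "bounded (f ` {s. 0 < Re s})"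
    using assms(2) by (auto simp: Hinf_dirichlet_def halfplane_def)
  obtain M where M: "\<And>s. 0 < Re s \<Longrightarrow> norm (f s) \<le> M"
    using bdd by (auto simp: bounded_iff)
  obtain C where C: "0 < C" "\<And>s. 0 < Re s \<Longrightarrow> norm (f s - a 1) * (1 + (Re s)\<^sup>2) \<le> C"
    using Hinf_dirichlet_decay[OF assms(2)] by blast
  interpret decaying_half_plane f M "8 * C"
    using hol M deriv_decay_half_plane[OF hol C(2)] by unfold_locales auto
  \<comment> \<open>A limit along a sequence is measurable without any exceptional set, and agrees
    with the horizontal limit wherever that exists.\<close>
  define g where "g \<tau> = lim (\<lambda>n. f (Complex (\<delta> n) \<tau>))" for \<tau>
  have g: "g \<in> borel_measurable lborel"
    unfolding g_def
  proof (rule borel_measurable_lim_metric)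
    fix n
    have "continuous_on UNIV (\<lambda>t. f (Complex (\<delta> n) t))"
      using \<delta>(1) by (intro continuous_on_Complex hol continuous_intros) auto
    then show "(\<lambda>t. f (Complex (\<delta> n) t)) \<in> borel_measurable lborel"
      using borel_measurable_continuous_onI by simp
  qed
  have lim: "AE \<tau> in lborel. ((\<lambda>\<sigma>. f (Complex \<sigma> \<tau>)) \<longlongrightarrow> g \<tau>) (at_right 0)"
    using Fatou_half_plane[OF hol bdd]
  proof eventually_elim
    case (elim \<tau>)
    then obtain l where l: "((\<lambda>\<sigma>. f (Complex \<sigma> \<tau>)) \<longlongrightarrow> l) (at_right 0)" by blast
    then have "g \<tau> = l"
      unfolding g_def by (intro limI filterlim_compose[OF l \<delta>_at_right])
    then show ?case using l by simp
  qed
  have lim_inf: "((\<lambda>x. f (Complex x t)) \<longlongrightarrow> a 1) at_top" for t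
  proof (rule LIM_zero_cancel, rule Lim_null_comparison)
    show "\<forall>\<^sub>F x in at_top. norm (f (Complex x t) - a 1) \<le> C / (1 + x\<^sup>2)"
      using eventually_gt_at_top[of 0]
    proof eventually_elim
      case (elim x)
      then show ?case
        using C(2)[of "Complex x t"] by (simp add: pos_le_divide_eq add_pos_nonneg)
    qed
    show "((\<lambda>x. C / (1 + x\<^sup>2)) \<longlongrightarrow> 0) at_top"
      by (rule divide_one_plus_square_tendsto_0)
  qed
  define B where "B = 2 * pi * K p * (8 * C)"
  have "((\<lambda>T. \<bar>(1 / (2 * T)) * (LBINT \<tau>=-T..T. norm (g \<tau>) powr p)
            - norm (a 1) powr p - p\<^sup>2 / (2 * T) * enn2real (LP_area f p T)\<bar>) \<longlongrightarrow> 0) at_top"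
  proof (rule Lim_null_comparison)
    show "\<forall>\<^sub>F T in at_top. norm \<bar>(1 / (2 * T)) * (LBINT \<tau>=-T..T. norm (g \<tau>) powr p)
            - norm (a 1) powr p - p\<^sup>2 / (2 * T) * enn2real (LP_area f p T)\<bar> \<le> B / (2 * T)"
      using eventually_gt_at_top[of 0]
    proof eventually_elim
      case (elim T)
      have I: "(LBINT \<tau>=-T..T. norm (g \<tau>) powr p) = (LBINT \<tau>:{-T..T}. norm (g \<tau>) powr p)"
        using elim by (simp add: interval_integral_Icc)
      have "\<bar>(LBINT t:{-T..T}. norm (g t) powr p) - 2 * T * norm (a 1) powr p - p\<^sup>2 * enn2real (LP_area f p T)\<bar> / (2 * T) \<le> B / (2 * T)"
        unfolding B_def using elim
        by (intro divide_right_mono Littlewood_Paley_bound assms(1) g lim lim_inf) auto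
      moreover have "\<bar>(LBINT t:{-T..T}. norm (g t) powr p) - 2 * T * norm (a 1) powr p - p\<^sup>2 * enn2real (LP_area f p T)\<bar> / (2 * T)
        = \<bar>((LBINT t:{-T..T}. norm (g t) powr p) - 2 * T * norm (a 1) powr p - p\<^sup>2 * enn2real (LP_area f p T)) / (2 * T)\<bar>"
        using elim by simp
      ultimately show ?case
        using elim by (simp add: I diff_divide_distrib)
    qed
    show "((\<lambda>T. B / (2 * T)) \<longlongrightarrow> 0) at_top"
      by (intro tendsto_divide_0[OF tendsto_const] filterlim_at_top_imp_at_infinity
          filterlim_tendsto_pos_mult_at_top[OF tendsto_const] filterlim_ident) simp
  qed
  moreover have "\<forall>\<^sub>F T in at_top. LP_area f p T < \<infinity>"
    using eventually_gt_at_top[of 0] by eventually_elim (rule LP_area_finite[OF assms(1)], simp)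
  ultimately show ?thesis
    using g lim by blast
qed

end
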